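(* Let $\mathcal A$ be a category. Then $$\Phi:\{\text{bi-reflective pairs in }\mathcal A\}\longrightarrow\{\text{bi-reflective model structures on }\mathcal A\},\qquad (\mathcal C,\mathcal F)\longmapsto(\mathcal E_t,\ \mathcal M_r,\ \mathcal M_t\circ\mathcal E_r)$$ is a bijection, where $t$ is the coreflector of $\mathcal C$ with counit $\varepsilon$, $r$ is the reflector of $\mathcal F$ with unit $\eta$, and - $\mathcal E_t$ is the class of morphisms $f:X\to Y$ such that the commutative square $f\circ\varepsilon_X=\varepsilon_Y\circ t(f)$ (with vertices $tX,X,tY,Y$) is a pushout; - $\mathcal M_t=\{f\in\mathrm{Mor}(\mathcal A)\mid t(f)\text{ is an isomorphism}\}$; - $\mathcal E_r=\{f\in\mathrm{Mor}(\mathcal A)\mid r(f)\text{ is an isomorphism}\}$; - $\mathcal M_r$ is the class of morphisms $f:X\to Y$ such that the commutative square $r(f)\circ\eta_X=\eta_Y\circ f$ (with vertices $X,rX,Y,rY$) is a pullback. The inverse of $\Phi$ is $\Psi:(\mathrm{CoFib},\mathrm{Fib},\mathrm{Weq})\longmapsto(\mathcal C,\mathcal F)$, where $\mathcal C$ and $\mathcal F$ are respectively the classes of cofibrant objects and fibrant objects.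
   Context: Notation: $\mathcal T\circ\mathcal S=\{p\circ u\mid u\in\mathcal S,\ p\in\mathcal T\}$; $\mathcal S\perp\mathcal T$ means that for all $u:A\to B$ in $\mathcal S$, $f:X\to Y$ in $\mathcal T$ and every commutative square $f\circ x=y\circ u$ there is a unique $d:B\to X$ with $d\circ u=x$, $f\circ d=y$. A class of morphisms has the two-out-of-three property if whenever two of $f,g,g\circ f$ lie in it so does the third. Full subcategories are closed under isomorphisms. (Co)reflective subcategories: a full subcategory $\mathcal F\subseteq\mathcal A$ is reflective if the inclusion has a left adjoint $r:\mathcal A\to\mathcal F$ (reflector), with unit $\eta$; $\mathcal C\subseteq\mathcal A$ is coreflective if the inclusion has a right adjoint $t:\mathcal A\to\mathcal C$ (coreflector), with counit $\varepsilon$. A left $\mathcal F$-strong-approximation of $A$ is a morphism $u:A\to F$ with $F\in\mathcal F$ such that every $A\to F'$ with $F'\in\mathcal F$ factors uniquely through $u$; dually, a right $\mathcal C$-strong-approximation of $A$ is a morphism $c:C\to A$ with $C\in\mathcal C$ such that every $C'\to A$ with $C'\in\mathcal C$ factors uniquely through $c$. The reflector $r$ is semi-left-exact if for every left $\mathcal F$-strong-approximation $u:A\to F$ and every $g:E\to F$ with $E\in\mathcal F$ the pullback of $u$ along $g$ exists in $\mathcal A$ and the projection $u':P\to E$ is a left $\mathcal F$-strong-approximation of $P$. Dually, the coreflector $t$ is semi-right-exact if for every right $\mathcal C$-strong-approximation $c:C\to A$ and every $h:C\to D$ with $D\in\mathcal C$ the pushout of $c$ along $h$ exists and the coprojection $c':D\to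 Q$ is a right $\mathcal C$-strong-approximation of $Q$. A bi-reflective pair in $\mathcal A$ is a pair $(\mathcal C,\mathcal F)$ of full subcategories such that: (A1) $\mathcal C$ is coreflective with semi-right-exact coreflector $t$, and $\mathcal F$ is reflective with semi-left-exact reflector $r$; and, with $\mathcal E_t,\mathcal M_t,\mathcal E_r,\mathcal M_r$ as in the claim, (A2) $\mathcal E_r\perp\mathcal M_t$; (A3) $\mathcal E_r\circ\mathcal M_t\subseteq\mathcal M_t\circ\mathcal E_r$. Model structures: a model structure on $\mathcal A$ is a triple $(\mathrm{CoFib},\mathrm{Fib},\mathrm{Weq})$ of classes of morphisms such that, with $\mathrm{TCoFib}:=\mathrm{CoFib}\cap\mathrm{Weq}$ and $\mathrm{TFib}:=\mathrm{Fib}\cap\mathrm{Weq}$: (CM1) $\mathrm{Weq}$ has the two-out-of-three property; (CM2) the three classes are closed under retracts; (CM3) every commutative square from $i$ to $p$ with $i\in\mathrm{TCoFib}$, $p\in\mathrm{Fib}$ or $i\in\mathrm{CoFib}$, $p\in\mathrm{TFib}$ has a lifting; (CM4) every morphism factors as $p\circ i$ with $i\in\mathrm{TCoFib}$, $p\in\mathrm{Fib}$ and as $q\circ j$ with $j\in\mathrm{CoFib}$, $q\in\mathrm{TFib}$. It is orthogonal if the liftings in (CM3) are unique. For an orthogonal model structure, an object $C$ is cofibrant if for every $p:X\to Y$ in $\mathrm{TFib}$ and $u:C\to Y$ there is a unique $v:C\to X$ with $p\circ v=u$; $F$ is fibrant if for every $i:X\to Y$ in $\mathrm{TCoFib}$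 and $u:X\to F$ there is a unique $v:Y\to F$ with $v\circ i=u$. $\mathcal A$ has enough cofibrant (fibrant) objects if for every $A$ there is a morphism $C\to A$ in $\mathrm{TFib}$ with $C$ cofibrant (a morphism $A\to F$ in $\mathrm{TCoFib}$ with $F$ fibrant). A bi-reflective model structure is an orthogonal model structure such that: (M1) $\mathcal A$ has enough cofibrant and enough fibrant objects; let $\mathcal C,\mathcal F$ be the classes of cofibrant and fibrant objects; (M2) $\mathrm{TCoFib}$ and $\mathrm{TFib}$ have the two-out-of-three property; (M3) for every $p:C\to D$ in $\mathrm{TFib}$ with $C\in\mathcal C$ and every $u:C\to E$ in $\mathrm{CoFib}$, the pushout of $p$ along $u$ exists and the coprojection $q:E\to Q$ is in $\mathrm{TFib}$; (M3') for every $i:X\to Z$ in $\mathrm{TCoFib}$ with $Z\in\mathcal F$ and every $v:Y\to Z$ in $\mathrm{Fib}$, the pullback of $i$ along $v$ exists and the projection $j:P\to Y$ is in $\mathrm{TCoFib}$. *)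

theory Defs
  imports Main
begin

section \<open>Categories, functors, adjunctions\<close>

record ('o, 'm) cat =
  Ob :: "'o set"
  Mor :: "'m set"
  Dom :: "'m \<Rightarrow> 'o"
  Cod :: "'m \<Rightarrow> 'o"
  Ident :: "'o \<Rightarrow> 'm"
  Comp :: "'m \<Rightarrow> 'm \<Rightarrow> 'm" (infixl "\<cdot>\<index>" 70)

definition Hom :: "('o, 'm) cat \<Rightarrow> 'o \<Rightarrow> 'o \<Rightarrow> 'm set" where
  "Hom A X Y = {f \<in> Mor A. Dom A f = X \<and> Cod A f = Y}"

text \<open>Composition is total as a HOL function but is only constrained on composable pairs;
  \<open>g \<cdot> f\<close> means first \<open>f\<close>, then \<open>g\<close>.\<close>

locale category =
  fixes A :: "('o, 'm) cat" (structure)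
  assumes Dom_in_Ob: "f \<in> Mor A \<Longrightarrow> Dom A f \<in> Ob A"
    and Cod_in_Ob: "f \<in> Mor A \<Longrightarrow> Cod A f \<in> Ob A"
    and Ident_in_Hom: "X \<in> Ob A \<Longrightarrow> Ident A X \<in> Hom A X X"
    and Comp_in_Hom: "\<lbrakk>f \<in> Hom A X Y; g \<in> Hom A Y Z\<rbrakk> \<Longrightarrow> g \<cdot> f \<in> Hom A X Z"
    and Comp_Ident_right: "f \<in> Hom A X Y \<Longrightarrow> f \<cdot> Ident A X = f"
    and Comp_Ident_left: "f \<in> Hom A X Y \<Longrightarrow> Ident A Y \<cdot> f = f"
    and Comp_assoc: "\<lbrakk>f \<in> Hom A W X; g \<in> Hom A X Y; h \<in> Hom A Y Z\<rbrakk>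
      \<Longrightarrow> (h \<cdot> g) \<cdot> f = h \<cdot> (g \<cdot> f)"

record ('o1, 'm1, 'o2, 'm2) functor_data =
  FOb :: "'o1 \<Rightarrow> 'o2"
  FMor :: "'m1 \<Rightarrow> 'm2"

locale cat_functor = A: category A + B: category B
  for A :: "('o1, 'm1) cat" and B :: "('o2, 'm2) cat" +
  fixes F :: "('o1, 'm1, 'o2, 'm2) functor_data"
  assumes FOb_in_Ob: "X \<in> Ob A \<Longrightarrow> FOb F X \<in> Ob B"
    and FMor_in_Hom: "f \<in> Hom A X Y \<Longrightarrow> FMor F f \<in> Hom B (FOb F X) (FOb F Y)"
    and FMor_Ident: "X \<in> Ob A \<Longrightarrow> FMor F (Ident A X) = Ident B (FOb F X)"
    and FMor_Comp: "\<lbrakk>f \<in> Hom A X Y; g \<in> Hom A Y Z\<rbrakk>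
      \<Longrightarrow> FMor F (g \<cdot>\<^bsub>A\<^esub> f) = FMor F g \<cdot>\<^bsub>B\<^esub> FMor F f"

definition id_functor :: "('o, 'm, 'o, 'm) functor_data" where
  "id_functor = \<lparr>FOb = (\<lambda>X. X), FMor = (\<lambda>f. f)\<rparr>"

definition comp_functor ::
  "('o2, 'm2, 'o3, 'm3) functor_data \<Rightarrow> ('o1, 'm1, 'o2, 'm2) functor_data
    \<Rightarrow> ('o1, 'm1, 'o3, 'm3) functor_data" where
  "comp_functor G F = \<lparr>FOb = (\<lambda>X. FOb G (FOb F X)), FMor = (\<lambda>f. FMor G (FMor F f))\<rparr>"

locale nat_transf = F: cat_functor A B F + G: cat_functor A B G
  for A :: "('o1, 'm1) cat" and B :: "('o2, 'm2) cat"
    and F G :: "('o1, 'm1, 'o2, 'm2) functor_data" +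
  fixes \<alpha> :: "'o1 \<Rightarrow> 'm2"
  assumes component_in_Hom: "X \<in> Ob A \<Longrightarrow> \<alpha> X \<in> Hom B (FOb F X) (FOb G X)"
    and naturality: "f \<in> Hom A X Y \<Longrightarrow> FMor G f \<cdot>\<^bsub>B\<^esub> \<alpha> X = \<alpha> Y \<cdot>\<^bsub>B\<^esub> FMor F f"

text \<open>\<open>L : A \<rightarrow> B\<close> is left adjoint to \<open>R : B \<rightarrow> A\<close> with unit \<open>\<eta>\<close> and counit \<open>\<epsilon>\<close>.\<close>

locale adjunction =
  L: cat_functor A B L + R: cat_functor B A R +
  unit: nat_transf A A id_functor "comp_functor R L" \<eta> +
  counit: nat_transf B B "comp_functor L R" id_functor \<epsilon>
  for A :: "('o1, 'm1) cat" and B :: "('o2, 'm2) cat"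
    and L :: "('o1, 'm1, 'o2, 'm2) functor_data"
    and R :: "('o2, 'm2, 'o1, 'm1) functor_data"
    and \<eta> :: "'o1 \<Rightarrow> 'm1" and \<epsilon> :: "'o2 \<Rightarrow> 'm2" +
  assumes triangle_L: "X \<in> Ob A \<Longrightarrow> \<epsilon> (FOb L X) \<cdot>\<^bsub>B\<^esub> FMor L (\<eta> X) = Ident B (FOb L X)"
    and triangle_R: "Y \<in> Ob B \<Longrightarrow> FMor R (\<epsilon> Y) \<cdot>\<^bsub>A\<^esub> \<eta> (FOb R Y) = Ident A (FOb R Y)"

definition full_sub :: "('o, 'm) cat \<Rightarrow> 'o set \<Rightarrow> ('o, 'm) cat" where
  "full_sub A F = A\<lparr>Ob := F, Mor := {f \<in> Mor A. Dom A f \<in> F \<and> Cod A f \<in> F}\<rparr>"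

lemma (in category) category_full_sub:
  assumes "F \<subseteq> Ob A"
  shows "category (full_sub A F)"
proof -
  have Hom_sub: "f \<in> Hom (full_sub A F) X Y \<longleftrightarrow> f \<in> Hom A X Y \<and> X \<in> F \<and> Y \<in> F" for f X Y
    by (auto simp: Hom_def full_sub_def)
  have sel: "Ob (full_sub A F) = F" "Ident (full_sub A F) = Ident A" "Comp (full_sub A F) = Comp A"
    by (simp_all add: full_sub_def)
  show ?thesis
  proof (unfold_locales, unfold Hom_sub sel)
    fix f assume "f \<in> Mor (full_sub A F)"
    then show "Dom (full_sub A F) f \<in> F" "Cod (full_sub A F) f \<in> F"
      by (simp_all add: full_sub_def)
  qed (use assms Ident_in_Hom Comp_in_Hom Comp_Ident_right Comp_Ident_left Comp_assoc in blast)+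
qed

text \<open>The inclusion of \<open>full_sub A F\<close> into \<open>A\<close> is given by \<open>id_functor\<close>.\<close>

lemma (in category) inclusion_functor:
  assumes "F \<subseteq> Ob A"
  shows "cat_functor (full_sub A F) A id_functor"
proof -
  interpret S: category "full_sub A F"
    using assms by (rule category_full_sub)
  show ?thesis
    using assms by unfold_locales (auto simp: id_functor_def full_sub_def Hom_def)
qed

section \<open>Bi-reflective pairs and bi-reflective model structures\<close>

context category
begin

abbreviation hom :: "'o \<Rightarrow> 'o \<Rightarrow> 'm set" where
  "hom \<equiv> Hom A"

definition iso :: "'m \<Rightarrow> bool" where
  "iso f \<longleftrightarrow> f \<in> Mor A \<and> (\<exists>g \<in> hom (Cod A f) (Dom A f).
     g \<cdot> f = Ident A (Dom A f) \<and> f \<cdot> g = Ident A (Cod A f))"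

definition pullback_square :: "'m \<Rightarrow> 'm \<Rightarrow> 'm \<Rightarrow> 'm \<Rightarrow> bool" where
  \<comment> \<open>\<open>f \<cdot> p = g \<cdot> q\<close> exhibits \<open>p : P \<rightarrow> X\<close>, \<open>q : P \<rightarrow> Y\<close> as the pullback of
      \<open>f : X \<rightarrow> Z\<close> and \<open>g : Y \<rightarrow> Z\<close>\<close>
  "pullback_square p q f g \<longleftrightarrow>
    (\<exists>P X Y Z. p \<in> hom P X \<and> q \<in> hom P Y \<and> f \<in> hom X Z \<and> g \<in> hom Y Z \<and> f \<cdot> p = g \<cdot> q \<and>
      (\<forall>W. \<forall>x \<in> hom W X. \<forall>y \<in> hom W Y. f \<cdot> x = g \<cdot> y \<longrightarrow>
        (\<exists>!d. d \<in> hom W P \<and> p \<cdot> d = x \<and> q \<cdot> d = y)))"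

definition pushout_square :: "'m \<Rightarrow> 'm \<Rightarrow> 'm \<Rightarrow> 'm \<Rightarrow> bool" where
  \<comment> \<open>\<open>p \<cdot> f = q \<cdot> g\<close> exhibits \<open>p : X \<rightarrow> P\<close>, \<open>q : Y \<rightarrow> P\<close> as the pushout of
      \<open>f : Z \<rightarrow> X\<close> and \<open>g : Z \<rightarrow> Y\<close>\<close>
  "pushout_square f g p q \<longleftrightarrow>
    (\<exists>P X Y Z. f \<in> hom Z X \<and> g \<in> hom Z Y \<and> p \<in> hom X P \<and> q \<in> hom Y P \<and> p \<cdot> f = q \<cdot> g \<and>
      (\<forall>W. \<forall>x \<in> hom X W. \<forall>y \<in> hom Y W. x \<cdot> f = y \<cdot> g \<longrightarrow>
        (\<exists>!d. d \<in> hom P W \<and> d \<cdot> p = x \<and> d \<cdot> q = y)))"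

definition class_comp :: "'m set \<Rightarrow> 'm set \<Rightarrow> 'm set" where
  "class_comp T S = {p \<cdot> u | p u. u \<in> S \<and> p \<in> T \<and> Cod A u = Dom A p}"

definition comm_square :: "'m \<Rightarrow> 'm \<Rightarrow> 'm \<Rightarrow> 'm \<Rightarrow> bool" where
  \<comment> \<open>a commutative square \<open>f \<cdot> x = y \<cdot> u\<close> from \<open>u\<close> to \<open>f\<close>\<close>
  "comm_square u f x y \<longleftrightarrow>
    x \<in> hom (Dom A u) (Dom A f) \<and> y \<in> hom (Cod A u) (Cod A f) \<and> f \<cdot> x = y \<cdot> u"

definition is_lifting :: "'m \<Rightarrow> 'm \<Rightarrow> 'm \<Rightarrow> 'm \<Rightarrow> 'm \<Rightarrow> bool" where
  "is_lifting u f x y d \<longleftrightarrow> d \<in> hom (Cod A u) (Dom A f) \<and> d \<cdot> u = x \<and> f \<cdot> d = y"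

definition has_liftings :: "'m set \<Rightarrow> 'm set \<Rightarrow> bool" where
  "has_liftings S T \<longleftrightarrow>
    (\<forall>u \<in> S. \<forall>f \<in> T. \<forall>x y. comm_square u f x y \<longrightarrow> (\<exists>d. is_lifting u f x y d))"

definition orthogonal :: "'m set \<Rightarrow> 'm set \<Rightarrow> bool" where
  "orthogonal S T \<longleftrightarrow>
    (\<forall>u \<in> S. \<forall>f \<in> T. \<forall>x y. comm_square u f x y \<longrightarrow> (\<exists>!d. is_lifting u f x y d))"

definition two_out_of_three :: "'m set \<Rightarrow> bool" where
  "two_out_of_three W \<longleftrightarrow>
    (\<forall>f \<in> Mor A. \<forall>g \<in> Mor A. Cod A f = Dom A g \<longrightarrow>
      (f \<in> W \<and> g \<in> W \<longrightarrow> g \<cdot> f \<in> W) \<and>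
      (f \<in> W \<and> g \<cdot> f \<in> W \<longrightarrow> g \<in> W) \<and>
      (g \<in> W \<and> g \<cdot> f \<in> W \<longrightarrow> f \<in> W))"

definition retract_of :: "'m \<Rightarrow> 'm \<Rightarrow> bool" where
  "retract_of f g \<longleftrightarrow> f \<in> Mor A \<and> g \<in> Mor A \<and>
    (\<exists>s s' p p'. comm_square f g s s' \<and> comm_square g f p p' \<and>
      p \<cdot> s = Ident A (Dom A f) \<and> p' \<cdot> s' = Ident A (Cod A f))"

definition retract_closed :: "'m set \<Rightarrow> bool" where
  "retract_closed W \<longleftrightarrow> (\<forall>f g. g \<in> W \<longrightarrow> retract_of f g \<longrightarrow> f \<in> W)"


subsection \<open>Reflective and coreflective subcategories\<close>

definition full_subcategory :: "'o set \<Rightarrow> bool" where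
  \<comment> \<open>full subcategories are given by their objects, and are closed under isomorphisms\<close>
  "full_subcategory F \<longleftrightarrow> F \<subseteq> Ob A \<and> (\<forall>f. iso f \<longrightarrow> Dom A f \<in> F \<longrightarrow> Cod A f \<in> F)"

definition reflection :: "'o set \<Rightarrow> ('o, 'm, 'o, 'm) functor_data \<Rightarrow> ('o \<Rightarrow> 'm) \<Rightarrow> bool" where
  "reflection F r \<eta> \<longleftrightarrow> (\<exists>\<epsilon>. adjunction A (full_sub A F) r id_functor \<eta> \<epsilon>)"

definition coreflection :: "'o set \<Rightarrow> ('o, 'm, 'o, 'm) functor_data \<Rightarrow> ('o \<Rightarrow> 'm) \<Rightarrow> bool" where
  "coreflection C t \<epsilon> \<longleftrightarrow> (\<exists>\<eta>. adjunction (full_sub A C) A id_functor t \<eta> \<epsilon>)"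

definition reflective :: "'o set \<Rightarrow> bool" where
  "reflective F \<longleftrightarrow> full_subcategory F \<and> (\<exists>r \<eta>. reflection F r \<eta>)"

definition coreflective :: "'o set \<Rightarrow> bool" where
  "coreflective C \<longleftrightarrow> full_subcategory C \<and> (\<exists>t \<epsilon>. coreflection C t \<epsilon>)"

text \<open>The (co)reflector together with its (co)unit is only determined up to isomorphism;
  one choice is fixed here.\<close>

definition reflector :: "'o set \<Rightarrow> ('o, 'm, 'o, 'm) functor_data \<times> ('o \<Rightarrow> 'm)" where
  "reflector F = (SOME (r, \<eta>). reflection F r \<eta>)"

definition coreflector :: "'o set \<Rightarrow> ('o, 'm, 'o, 'm) functor_data \<times> ('o \<Rightarrow> 'm)" where
  "coreflector C = (SOME (t, \<epsilon>). coreflection C t \<epsilon>)"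

definition left_strong_approx :: "'o set \<Rightarrow> 'm \<Rightarrow> bool" where
  "left_strong_approx F u \<longleftrightarrow> u \<in> Mor A \<and> Cod A u \<in> F \<and>
    (\<forall>F' \<in> F. \<forall>v \<in> hom (Dom A u) F'. \<exists>!w. w \<in> hom (Cod A u) F' \<and> w \<cdot> u = v)"

definition right_strong_approx :: "'o set \<Rightarrow> 'm \<Rightarrow> bool" where
  "right_strong_approx C c \<longleftrightarrow> c \<in> Mor A \<and> Dom A c \<in> C \<and>
    (\<forall>C' \<in> C. \<forall>v \<in> hom C' (Cod A c). \<exists>!w. w \<in> hom C' (Dom A c) \<and> c \<cdot> w = v)"

definition semi_left_exact :: "'o set \<Rightarrow> bool" where
  "semi_left_exact F \<longleftrightarrow>
    (\<forall>u g. left_strong_approx F u \<longrightarrow> g \<in> Mor A \<longrightarrow> Dom A g \<in> F \<longrightarrow> Cod A g = Cod A u \<longrightarrow>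
      (\<exists>g' u'. pullback_square g' u' u g \<and> left_strong_approx F u'))"

definition semi_right_exact :: "'o set \<Rightarrow> bool" where
  "semi_right_exact C \<longleftrightarrow>
    (\<forall>c h. right_strong_approx C c \<longrightarrow> h \<in> Mor A \<longrightarrow> Cod A h \<in> C \<longrightarrow> Dom A h = Dom A c \<longrightarrow>
      (\<exists>h' c'. pushout_square c h h' c' \<and> right_strong_approx C c'))"

definition E_coref :: "('o, 'm, 'o, 'm) functor_data \<Rightarrow> ('o \<Rightarrow> 'm) \<Rightarrow> 'm set" where
  "E_coref t \<epsilon> = {f \<in> Mor A. pushout_square (\<epsilon> (Dom A f)) (FMor t f) f (\<epsilon> (Cod A f))}"

definition M_coref :: "('o, 'm, 'o, 'm) functor_data \<Rightarrow> 'm set" where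
  "M_coref t = {f \<in> Mor A. iso (FMor t f)}"

definition E_ref :: "('o, 'm, 'o, 'm) functor_data \<Rightarrow> 'm set" where
  "E_ref r = {f \<in> Mor A. iso (FMor r f)}"

definition M_ref :: "('o, 'm, 'o, 'm) functor_data \<Rightarrow> ('o \<Rightarrow> 'm) \<Rightarrow> 'm set" where
  "M_ref r \<eta> = {f \<in> Mor A. pullback_square (\<eta> (Dom A f)) f (FMor r f) (\<eta> (Cod A f))}"

definition bireflective_pairs :: "('o set \<times> 'o set) set" where
  "bireflective_pairs = {(C, F).
    coreflective C \<and> semi_right_exact C \<and> reflective F \<and> semi_left_exact F \<and>
    (let t = fst (coreflector C); r = fst (reflector F) in
      orthogonal (E_ref r) (M_coref t) \<and>
      class_comp (E_ref r) (M_coref t) \<subseteq> class_comp (M_coref t) (E_ref r))}"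


subsection \<open>Model structures\<close>

text \<open>A triple is ordered as (cofibrations, fibrations, weak equivalences).\<close>

definition model_structure :: "'m set \<times> 'm set \<times> 'm set \<Rightarrow> bool" where
  "model_structure = (\<lambda>(CoFib, Fib, Weq).
    CoFib \<subseteq> Mor A \<and> Fib \<subseteq> Mor A \<and> Weq \<subseteq> Mor A \<and>
    two_out_of_three Weq \<and>
    retract_closed CoFib \<and> retract_closed Fib \<and> retract_closed Weq \<and>
    has_liftings (CoFib \<inter> Weq) Fib \<and> has_liftings CoFib (Fib \<inter> Weq) \<and>
    Mor A \<subseteq> class_comp Fib (CoFib \<inter> Weq) \<and>
    Mor A \<subseteq> class_comp (Fib \<inter> Weq) CoFib)"

definition orthogonal_model_structure :: "'m set \<times> 'm set \<times> 'm set \<Rightarrow> bool" where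
  "orthogonal_model_structure = (\<lambda>(CoFib, Fib, Weq).
    model_structure (CoFib, Fib, Weq) \<and>
    orthogonal (CoFib \<inter> Weq) Fib \<and> orthogonal CoFib (Fib \<inter> Weq))"

definition cofibrant_objects :: "'m set \<times> 'm set \<times> 'm set \<Rightarrow> 'o set" where
  "cofibrant_objects = (\<lambda>(CoFib, Fib, Weq). {C \<in> Ob A.
    \<forall>p \<in> Fib \<inter> Weq. \<forall>u \<in> hom C (Cod A p). \<exists>!v. v \<in> hom C (Dom A p) \<and> p \<cdot> v = u})"

definition fibrant_objects :: "'m set \<times> 'm set \<times> 'm set \<Rightarrow> 'o set" where
  "fibrant_objects = (\<lambda>(CoFib, Fib, Weq). {F \<in> Ob A.
    \<forall>i \<in> CoFib \<inter> Weq. \<forall>u \<in> hom (Dom A i) F. \<exists>!v. v \<in> hom (Cod A i) F \<and> v \<cdot> i = u})"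

definition enough_cofibrant :: "'m set \<times> 'm set \<times> 'm set \<Rightarrow> bool" where
  "enough_cofibrant = (\<lambda>(CoFib, Fib, Weq).
    \<forall>X \<in> Ob A. \<exists>C \<in> cofibrant_objects (CoFib, Fib, Weq). \<exists>p \<in> Fib \<inter> Weq. p \<in> hom C X)"

definition enough_fibrant :: "'m set \<times> 'm set \<times> 'm set \<Rightarrow> bool" where
  "enough_fibrant = (\<lambda>(CoFib, Fib, Weq).
    \<forall>X \<in> Ob A. \<exists>F \<in> fibrant_objects (CoFib, Fib, Weq). \<exists>i \<in> CoFib \<inter> Weq. i \<in> hom X F)"

definition bireflective_model_structures :: "('m set \<times> 'm set \<times> 'm set) set" where
  "bireflective_model_structures = {(CoFib, Fib, Weq).
    orthogonal_model_structure (CoFib, Fib, Weq) \<and>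
    enough_cofibrant (CoFib, Fib, Weq) \<and> enough_fibrant (CoFib, Fib, Weq) \<and>
    two_out_of_three (CoFib \<inter> Weq) \<and> two_out_of_three (Fib \<inter> Weq) \<and>
    (\<forall>p \<in> Fib \<inter> Weq. \<forall>u \<in> CoFib.
      Dom A p \<in> cofibrant_objects (CoFib, Fib, Weq) \<longrightarrow> Dom A u = Dom A p \<longrightarrow>
      (\<exists>w q. pushout_square p u w q \<and> q \<in> Fib \<inter> Weq)) \<and>
    (\<forall>i \<in> CoFib \<inter> Weq. \<forall>v \<in> Fib.
      Cod A i \<in> fibrant_objects (CoFib, Fib, Weq) \<longrightarrow> Cod A v = Cod A i \<longrightarrow>
      (\<exists>w j. pullback_square w j i v \<and> j \<in> CoFib \<inter> Weq))}"


subsection \<open>The two assignments\<close>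

definition induced_model ::
  "('o, 'm, 'o, 'm) functor_data \<Rightarrow> ('o \<Rightarrow> 'm) \<Rightarrow> ('o, 'm, 'o, 'm) functor_data \<Rightarrow> ('o \<Rightarrow> 'm)
    \<Rightarrow> 'm set \<times> 'm set \<times> 'm set" where
  "induced_model t \<epsilon> r \<eta> = (E_coref t \<epsilon>, M_ref r \<eta>, class_comp (M_coref t) (E_ref r))"

definition Phi :: "'o set \<times> 'o set \<Rightarrow> 'm set \<times> 'm set \<times> 'm set" where
  "Phi = (\<lambda>(C, F). let (t, \<epsilon>) = coreflector C; (r, \<eta>) = reflector F
    in induced_model t \<epsilon> r \<eta>)"

definition Psi :: "'m set \<times> 'm set \<times> 'm set \<Rightarrow> 'o set \<times> 'o set" where
  "Psi M = (cofibrant_objects M, fibrant_objects M)"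

end

end

theory Submission
  imports Defs
begin

text \<open>
  For a reflective subcategory \<open>F\<close> the class \<open>\<E>\<^sub>r\<close> consists of the morphisms that every object of \<open>F\<close>
  regards as isomorphisms (\<open>local_isos F\<close>), and semi-left-exactness makes \<open>(\<E>\<^sub>r, \<M>\<^sub>r)\<close> an orthogonal
  factorization system, so \<open>\<M>\<^sub>r = \<E>\<^sub>r\<^sup>\<bottom>\<close>; dually for \<open>(\<E>\<^sub>t, \<M>\<^sub>t)\<close>. None of these classes depends on the
  choice of adjoint. Given two such systems with \<open>\<E>\<^sub>r \<bottom> \<M>\<^sub>t\<close>, if \<open>p \<cdot> i \<in> \<M>\<^sub>t \<circ> \<E>\<^sub>r\<close> with
  \<open>i \<in> \<E>\<^sub>r\<close> and \<open>p \<in> \<M>\<^sub>r\<close>, then \<open>p \<in> \<M>\<^sub>t\<close>, since both are \<open>(\<E>\<^sub>r, \<M>\<^sub>r)\<close>-factorizations of the same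
  morphism. Hence \<open>\<M>\<^sub>t\<close> and \<open>\<E>\<^sub>r\<close> are the trivial fibrations and cofibrations, and two-out-of-three for
  \<open>\<M>\<^sub>t \<circ> \<E>\<^sub>r\<close> reduces to that of \<open>\<M>\<^sub>t\<close> and \<open>\<E>\<^sub>r\<close>. Conversely, the trivial
  cofibrations of a bi-reflective model structure are exactly the morphisms local with respect to the
  fibrant objects, because a local isomorphism between fibrant objects is invertible.
\<close>

section \<open>Morphisms and orthogonality\<close>

context category
begin

text \<open>The axioms are recast with \<open>Mor\<close>, \<open>Dom\<close> and \<open>Cod\<close>
  in place of \<open>Hom\<close>, so that composability becomes equations between endpoints that the
  simplifier can discharge.\<close>

lemma comp_Mor [simp]: "\<lbrakk>f \<in> Mor A; g \<in> Mor A; Cod A f = Dom A g\<rbrakk> \<Longrightarrow> g \<cdot> f \<in> Mor A"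
  and Dom_comp [simp]: "\<lbrakk>f \<in> Mor A; g \<in> Mor A; Cod A f = Dom A g\<rbrakk> \<Longrightarrow> Dom A (g \<cdot> f) = Dom A f"
  and Cod_comp [simp]: "\<lbrakk>f \<in> Mor A; g \<in> Mor A; Cod A f = Dom A g\<rbrakk> \<Longrightarrow> Cod A (g \<cdot> f) = Cod A g"
  using Comp_in_Hom[of f "Dom A f" "Cod A f" g "Cod A g"] by (auto simp: Hom_def)

lemma Ident_Mor [simp]: "X \<in> Ob A \<Longrightarrow> Ident A X \<in> Mor A"
  and Dom_Ident [simp]: "X \<in> Ob A \<Longrightarrow> Dom A (Ident A X) = X"
  and Cod_Ident [simp]: "X \<in> Ob A \<Longrightarrow> Cod A (Ident A X) = X"
  using Ident_in_Hom[of X] by (auto simp: Hom_def)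

lemma comp_Ident_right [simp]: "\<lbrakk>f \<in> Mor A; X = Dom A f\<rbrakk> \<Longrightarrow> f \<cdot> Ident A X = f"
  and comp_Ident_left [simp]: "\<lbrakk>f \<in> Mor A; Y = Cod A f\<rbrakk> \<Longrightarrow> Ident A Y \<cdot> f = f"
  by (auto simp: Hom_def intro: Comp_Ident_right Comp_Ident_left)

lemma comp_assoc:
  "\<lbrakk>f \<in> Mor A; g \<in> Mor A; h \<in> Mor A; Cod A f = Dom A g; Cod A g = Dom A h\<rbrakk>
    \<Longrightarrow> (h \<cdot> g) \<cdot> f = h \<cdot> (g \<cdot> f)"
  by (rule Comp_assoc) (auto simp: Hom_def)

declare Dom_in_Ob [simp] Cod_in_Ob [simp]

lemma Hom_Ob: "f \<in> hom X Y \<Longrightarrow> X \<in> Ob A \<and> Y \<in> Ob A"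
  by (auto simp: Hom_def)

lemma isoI:
  assumes "f \<in> hom X Y" "g \<in> hom Y X" "g \<cdot> f = Ident A X" "f \<cdot> g = Ident A Y"
  shows "iso f"
  using assms unfolding iso_def Hom_def by auto

lemma isoE:
  assumes "iso f"
  obtains g where "f \<in> Mor A" "g \<in> Mor A" "Dom A g = Cod A f" "Cod A g = Dom A f"
    "g \<cdot> f = Ident A (Dom A f)" "f \<cdot> g = Ident A (Cod A f)"
  using assms unfolding iso_def Hom_def by auto

lemma iso_Ident: "X \<in> Ob A \<Longrightarrow> iso (Ident A X)"
  by (rule isoI[where g = "Ident A X"]) (auto simp: Hom_def)

lemma inverse_iso:
  assumes "iso f"
  obtains g where "iso g" "Dom A g = Cod A f" "Cod A g = Dom A f"
    "g \<cdot> f = Ident A (Dom A f)" "f \<cdot> g = Ident A (Cod A f)"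
proof -
  obtain g where g: "f \<in> Mor A" "g \<in> Mor A" "Dom A g = Cod A f" "Cod A g = Dom A f"
    "g \<cdot> f = Ident A (Dom A f)" "f \<cdot> g = Ident A (Cod A f)"
    using assms by (rule isoE)
  moreover have "iso g"
    using g by (intro isoI[of g "Cod A f" "Dom A f" f]) (auto simp: Hom_def)
  ultimately show ?thesis using that by blast
qed

section \<open>Unique lifting and the classes it defines\<close>

lemma orthogonalI:
  assumes "\<And>u f x y. \<lbrakk>u \<in> S; f \<in> T; x \<in> hom (Dom A u) (Dom A f); y \<in> hom (Cod A u) (Cod A f);
      f \<cdot> x = y \<cdot> u\<rbrakk> \<Longrightarrow> \<exists>d. d \<in> hom (Cod A u) (Dom A f) \<and> d \<cdot> u = x \<and> f \<cdot> d = y"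
    and "\<And>u f d d'. \<lbrakk>u \<in> S; f \<in> T; d \<in> hom (Cod A u) (Dom A f); d' \<in> hom (Cod A u) (Dom A f);
      d \<cdot> u = d' \<cdot> u; f \<cdot> d = f \<cdot> d'\<rbrakk> \<Longrightarrow> d = d'"
  shows "orthogonal S T"
  unfolding orthogonal_def comm_square_def is_lifting_def
proof (intro ballI allI impI)
  fix u f x y
  assume "u \<in> S" "f \<in> T" "x \<in> hom (Dom A u) (Dom A f) \<and> y \<in> hom (Cod A u) (Cod A f) \<and> f \<cdot> x = y \<cdot> u"
  then show "\<exists>!d. d \<in> hom (Cod A u) (Dom A f) \<and> d \<cdot> u = x \<and> f \<cdot> d = y"
    using assms(1)[of u f x y] assms(2)[of u f] by metis
qed

lemma orthogonal_ex:
  assumes "orthogonal S T" "u \<in> S" "f \<in> T" "x \<in> hom (Dom A u) (Dom A f)"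
    "y \<in> hom (Cod A u) (Cod A f)" "f \<cdot> x = y \<cdot> u"
  obtains d where "d \<in> hom (Cod A u) (Dom A f)" "d \<cdot> u = x" "f \<cdot> d = y"
  using assms unfolding orthogonal_def comm_square_def is_lifting_def by metis

text \<open>Cancellation form of uniqueness: \<open>d\<close> and \<open>d'\<close> are diagonals of
  one square, the one with sides \<open>d' \<cdot> u\<close> and
  \<open>f \<cdot> d'\<close>.\<close>

lemma orthogonal_unique:
  assumes "orthogonal S T" "u \<in> S" "f \<in> T" "u \<in> Mor A" "f \<in> Mor A"
    "d \<in> hom (Cod A u) (Dom A f)" "d' \<in> hom (Cod A u) (Dom A f)"
    "d \<cdot> u = d' \<cdot> u" "f \<cdot> d = f \<cdot> d'"
  shows "d = d'"
proof -
  have "comm_square u f (d' \<cdot> u) (f \<cdot> d')"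
    using assms(4-7) by (auto simp: comm_square_def Hom_def comp_assoc)
  then have "\<exists>!d. is_lifting u f (d' \<cdot> u) (f \<cdot> d') d"
    using assms(1-3) by (auto simp: orthogonal_def)
  then show ?thesis
    using assms(6-9) by (auto simp: is_lifting_def)
qed

lemma orthogonal_mono: "\<lbrakk>orthogonal S T; S' \<subseteq> S; T' \<subseteq> T\<rbrakk> \<Longrightarrow> orthogonal S' T'"
  unfolding orthogonal_def by blast

text \<open>Despite the names, \<open>llp\<close> and \<open>rlp\<close> require unique liftings:
  they are the orthogonal complements of a class, not the weak lifting classes of homotopy
  theory.\<close>

definition llp :: "'m set \<Rightarrow> 'm set" where
  "llp T = {f \<in> Mor A. orthogonal {f} T}"

definition rlp :: "'m set \<Rightarrow> 'm set" where
  "rlp S = {f \<in> Mor A. orthogonal S {f}}"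

lemma llp_subset_Mor: "llp T \<subseteq> Mor A" and rlp_subset_Mor: "rlp S \<subseteq> Mor A"
  by (auto simp: llp_def rlp_def)

lemma subset_rlp: "orthogonal S T \<Longrightarrow> T \<subseteq> Mor A \<Longrightarrow> T \<subseteq> rlp S"
  and subset_llp: "orthogonal S T \<Longrightarrow> S \<subseteq> Mor A \<Longrightarrow> S \<subseteq> llp T"
  unfolding rlp_def llp_def orthogonal_def by blast+

lemma orthogonal_rlp: "orthogonal S (rlp S)" and orthogonal_llp: "orthogonal (llp T) T"
  unfolding rlp_def llp_def orthogonal_def by blast+

text \<open>A square is lifted against \<open>g\<close> first; the resulting map into
  \<open>Dom A g\<close> is the lower side of a square that is then lifted against
  \<open>f\<close>.\<close>

lemma rlp_comp:
  assumes S: "S \<subseteq> Mor A" and f: "f \<in> rlp S" and g: "g \<in> rlp S" and fg: "Cod A f = Dom A g"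
  shows "g \<cdot> f \<in> rlp S"
proof -
  have [simp]: "f \<in> Mor A" "g \<in> Mor A" using f g rlp_subset_Mor by auto
  have "orthogonal S {g \<cdot> f}"
  proof (rule orthogonalI; clarify?)
    fix u h x y
    assume u: "u \<in> S" and x: "x \<in> hom (Dom A u) (Dom A (g \<cdot> f))"
      and y: "y \<in> hom (Cod A u) (Cod A (g \<cdot> f))" and eq: "(g \<cdot> f) \<cdot> x = y \<cdot> u"
    have [simp]: "u \<in> Mor A" using S u by auto
    obtain e where e: "e \<in> hom (Cod A u) (Dom A g)" "e \<cdot> u = f \<cdot> x" "g \<cdot> e = y"
      by (rule orthogonal_ex[OF orthogonal_rlp u g, of "f \<cdot> x" y])
        (use x y eq fg in \<open>auto simp: Hom_def comp_assoc\<close>)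
    obtain d where "d \<in> hom (Cod A u) (Dom A f)" "d \<cdot> u = x" "f \<cdot> d = e"
      by (rule orthogonal_ex[OF orthogonal_rlp u f, of x e]) (use x e fg in \<open>auto simp: Hom_def\<close>)
    then show "\<exists>d. d \<in> hom (Cod A u) (Dom A (g \<cdot> f)) \<and> d \<cdot> u = x \<and> (g \<cdot> f) \<cdot> d = y"
      using e fg by (intro exI[of _ d]) (auto simp: Hom_def comp_assoc)
  next
    fix u h d d'
    assume u: "u \<in> S" and d: "d \<in> hom (Cod A u) (Dom A (g \<cdot> f))" "d' \<in> hom (Cod A u) (Dom A (g \<cdot> f))"
      and eq: "d \<cdot> u = d' \<cdot> u" "(g \<cdot> f) \<cdot> d = (g \<cdot> f) \<cdot> d'"
    have [simp]: "u \<in> Mor A" using S u by auto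
    have "f \<cdot> d = f \<cdot> d'"
      by (rule orthogonal_unique[OF orthogonal_rlp u g])
        (use d eq fg in \<open>auto simp: Hom_def comp_assoc\<close>)
    show "d = d'"
      by (rule orthogonal_unique[OF orthogonal_rlp u f])
        (use d eq fg \<open>f \<cdot> d = f \<cdot> d'\<close> in \<open>auto simp: Hom_def\<close>)
  qed
  then show ?thesis using fg by (auto simp: rlp_def)
qed

text \<open>A square into \<open>f\<close> is carried to one into \<open>g\<close> by the sections
  \<open>s\<close>, \<open>s'\<close>, solved there, and the solution is brought back by
  \<open>p\<close>. Uniqueness is inherited because \<open>s\<close> is a split
  monomorphism.\<close>

lemma retract_closed_rlp:
  assumes S: "S \<subseteq> Mor A"
  shows "retract_closed (rlp S)"
  unfolding retract_closed_def
proof (intro allI impI)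
  fix f g assume g: "g \<in> rlp S" and "retract_of f g"
  then obtain s s' p p' where [simp]: "f \<in> Mor A" "g \<in> Mor A"
    and s: "s \<in> hom (Dom A f) (Dom A g)" "s' \<in> hom (Cod A f) (Cod A g)" "g \<cdot> s = s' \<cdot> f"
    and p: "p \<in> hom (Dom A g) (Dom A f)" "p' \<in> hom (Cod A g) (Cod A f)" "f \<cdot> p = p' \<cdot> g"
    and ps: "p \<cdot> s = Ident A (Dom A f)" "p' \<cdot> s' = Ident A (Cod A f)"
    by (auto simp: retract_of_def comm_square_def)
  \<comment> \<open>\<open>comp_assoc\<close> brackets everything to the right, which separates
    adjacent factors. Each identity is therefore also provided with a further morphism
    \<open>k\<close> on its right.\<close>
  have ps': "p \<cdot> (s \<cdot> k) = k" if "k \<in> Mor A" "Cod A k = Dom A f" for k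
    using comp_assoc[of k s p] that ps(1) s p by (auto simp: Hom_def)
  have ps'': "p' \<cdot> (s' \<cdot> k) = k" if "k \<in> Mor A" "Cod A k = Cod A f" for k
    using comp_assoc[of k s' p'] that ps(2) s p by (auto simp: Hom_def)
  have gs: "g \<cdot> (s \<cdot> k) = s' \<cdot> (f \<cdot> k)" if "k \<in> Mor A" "Cod A k = Dom A f" for k
    using that s comp_assoc[of k s g] comp_assoc[of k f s'] by (auto simp: Hom_def)
  have fp: "f \<cdot> (p \<cdot> k) = p' \<cdot> (g \<cdot> k)" if "k \<in> Mor A" "Cod A k = Dom A g" for k
    using that p comp_assoc[of k p f] comp_assoc[of k g p'] by (auto simp: Hom_def)
  have "orthogonal S {f}"
  proof (rule orthogonalI; clarify?)
    fix u x y
    assume u: "u \<in> S" and x: "x \<in> hom (Dom A u) (Dom A f)"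
      and y: "y \<in> hom (Cod A u) (Cod A f)" and eq: "f \<cdot> x = y \<cdot> u"
    have [simp]: "u \<in> Mor A" using S u by auto
    obtain d where d: "d \<in> hom (Cod A u) (Dom A g)" "d \<cdot> u = s \<cdot> x" "g \<cdot> d = s' \<cdot> y"
      by (rule orthogonal_ex[OF orthogonal_rlp u g, of "s \<cdot> x" "s' \<cdot> y"])
        (use x y s eq gs in \<open>auto simp: Hom_def comp_assoc\<close>)
    show "\<exists>d. d \<in> hom (Cod A u) (Dom A f) \<and> d \<cdot> u = x \<and> f \<cdot> d = y"
      using d x y p s ps' ps'' fp by (intro exI[of _ "p \<cdot> d"]) (auto simp: Hom_def comp_assoc)
  next
    fix u d d'
    assume u: "u \<in> S" and d: "d \<in> hom (Cod A u) (Dom A f)" "d' \<in> hom (Cod A u) (Dom A f)"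
      and eq: "d \<cdot> u = d' \<cdot> u" "f \<cdot> d = f \<cdot> d'"
    have [simp]: "u \<in> Mor A" using S u by auto
    have "s \<cdot> d = s \<cdot> d'"
      by (rule orthogonal_unique[OF orthogonal_rlp u g])
        (use d eq s gs in \<open>auto simp: Hom_def comp_assoc\<close>)
    moreover have "p \<cdot> (s \<cdot> d) = d" "p \<cdot> (s \<cdot> d') = d'"
      using d by (auto simp: Hom_def intro!: ps')
    ultimately show "d = d'" by metis
  qed
  then show "f \<in> rlp S" by (auto simp: rlp_def)
qed

lemma iso_in_rlp:
  assumes S: "S \<subseteq> Mor A" and f: "iso f"
  shows "f \<in> rlp S"
proof -
  obtain g where [simp]: "f \<in> Mor A" and g: "g \<in> Mor A" "Dom A g = Cod A f" "Cod A g = Dom A f"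
    "g \<cdot> f = Ident A (Dom A f)" "f \<cdot> g = Ident A (Cod A f)"
    using f by (rule isoE)
  have gf: "g \<cdot> (f \<cdot> k) = k" if "k \<in> Mor A" "Cod A k = Dom A f" for k
    using comp_assoc[of k f g] that g by auto
  have fg: "f \<cdot> (g \<cdot> k) = k" if "k \<in> Mor A" "Cod A k = Cod A f" for k
    using comp_assoc[of k g f] that g by auto
  have "orthogonal S {f}"
  proof (rule orthogonalI; clarify?)
    fix u x y
    assume u: "u \<in> S" and x: "x \<in> hom (Dom A u) (Dom A f)"
      and y: "y \<in> hom (Cod A u) (Cod A f)" and eq: "f \<cdot> x = y \<cdot> u"
    have [simp]: "u \<in> Mor A" using S u by auto
    have "g \<cdot> (y \<cdot> u) = x" using gf[of x] eq x by (auto simp: Hom_def)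
    then show "\<exists>d. d \<in> hom (Cod A u) (Dom A f) \<and> d \<cdot> u = x \<and> f \<cdot> d = y"
      using y g fg[of y] by (intro exI[of _ "g \<cdot> y"]) (auto simp: Hom_def comp_assoc)
  next
    fix u d d'
    assume "d \<in> hom (Cod A u) (Dom A f)" "d' \<in> hom (Cod A u) (Dom A f)" "f \<cdot> d = f \<cdot> d'"
    moreover have "g \<cdot> (f \<cdot> d) = d" "g \<cdot> (f \<cdot> d') = d'"
      using calculation(1,2) by (auto simp: Hom_def intro!: gf)
    ultimately show "d = d'" by metis
  qed
  then show ?thesis by (auto simp: rlp_def)
qed

text \<open>The square from \<open>e\<close> to \<open>m \<cdot> e\<close> with an identity on top
  and \<open>m\<close> below has a diagonal \<open>d\<close>, a left inverse of \<open>e\<close>. It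
  is also a right inverse, since \<open>e \<cdot> d\<close> and the identity agree after composing
  with \<open>e\<close> on one side and with \<open>m\<close> on the other.\<close>

lemma iso_of_orthogonal_factorization:
  assumes [simp]: "e \<in> Mor A" "m \<in> Mor A" and em: "Cod A e = Dom A m"
    and o: "orthogonal {e} {m}" "orthogonal {e} {m \<cdot> e}"
  shows "iso e"
proof -
  obtain d where d: "d \<in> hom (Cod A e) (Dom A e)" "d \<cdot> e = Ident A (Dom A e)" "(m \<cdot> e) \<cdot> d = m"
    by (rule orthogonal_ex[OF o(2), of e "m \<cdot> e" "Ident A (Dom A e)" m])
      (use em in \<open>auto simp: Hom_def\<close>)
  have "e \<cdot> d = Ident A (Cod A e)"
    by (rule orthogonal_unique[OF o(1), of e m])
      (use em d in \<open>auto simp: Hom_def comp_assoc\<close>)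
  then show ?thesis
    using d by (intro isoI[of e "Dom A e" "Cod A e" d]) (auto simp: Hom_def)
qed

lemma iso_of_orthogonal_self:
  assumes "orthogonal {e} {e}" "e \<in> Mor A"
  shows "iso e"
  using assms iso_in_rlp[OF _ iso_Ident, of "{e}" "Cod A e"]
  by (intro iso_of_orthogonal_factorization[of e "Ident A (Cod A e)"]) (auto simp: rlp_def)

section \<open>Pullbacks\<close>

text \<open>Composing with \<open>p\<close> and \<open>g\<close> turns a square into
  \<open>q\<close> into one into \<open>f\<close>. Its diagonal together with \<open>y\<close> is a
  cone over \<open>f\<close> and \<open>g\<close>, and the induced map to the pullback is the
  diagonal sought.\<close>

lemma pullback_in_rlp:
  assumes S: "S \<subseteq> Mor A" and pb: "pullback_square p q f g" and f: "f \<in> rlp S"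
  shows "q \<in> rlp S"
proof -
  from pb obtain P X Y Z where h: "p \<in> hom P X" "q \<in> hom P Y" "f \<in> hom X Z" "g \<in> hom Y Z"
    and sq: "f \<cdot> p = g \<cdot> q"
    and univ: "\<And>W x y. \<lbrakk>x \<in> hom W X; y \<in> hom W Y; f \<cdot> x = g \<cdot> y\<rbrakk>
      \<Longrightarrow> \<exists>!d. d \<in> hom W P \<and> p \<cdot> d = x \<and> q \<cdot> d = y"
    unfolding pullback_square_def by blast
  have sq': "f \<cdot> (p \<cdot> k) = g \<cdot> (q \<cdot> k)" if "k \<in> Mor A" "Cod A k = P" for k
    using that h sq comp_assoc[of k p f] comp_assoc[of k q g] by (auto simp: Hom_def)
  have "orthogonal S {q}"
  proof (rule orthogonalI; clarify?)
    fix u x y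
    assume u: "u \<in> S" and x: "x \<in> hom (Dom A u) (Dom A q)"
      and y: "y \<in> hom (Cod A u) (Cod A q)" and eq: "q \<cdot> x = y \<cdot> u"
    have [simp]: "u \<in> Mor A" using S u by auto
    obtain e where e: "e \<in> hom (Cod A u) (Dom A f)" "e \<cdot> u = p \<cdot> x" "f \<cdot> e = g \<cdot> y"
      by (rule orthogonal_ex[OF orthogonal_rlp u f, of "p \<cdot> x" "g \<cdot> y"])
        (use x y eq h sq' in \<open>auto simp: Hom_def comp_assoc\<close>)
    then obtain d where d: "d \<in> hom (Cod A u) P" "p \<cdot> d = e" "q \<cdot> d = y"
      using univ[of e "Cod A u" y] y h by (auto simp: Hom_def)
    \<comment> \<open>The upper triangle holds because \<open>d \<cdot> u\<close> and
      \<open>x\<close> induce the same cone with apex \<open>Dom A u\<close>.\<close>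
    have "d \<cdot> u = x"
      using univ[of "p \<cdot> x" "Dom A u" "q \<cdot> x"]
    proof (rule ex1E)
      show "p \<cdot> x \<in> hom (Dom A u) X" "q \<cdot> x \<in> hom (Dom A u) Y" "f \<cdot> (p \<cdot> x) = g \<cdot> (q \<cdot> x)"
        using x h sq' by (auto simp: Hom_def)
      fix k assume k: "\<forall>d'. d' \<in> hom (Dom A u) P \<and> p \<cdot> d' = p \<cdot> x \<and> q \<cdot> d' = q \<cdot> x \<longrightarrow> d' = k"
      have "x = k" using k x h by (auto simp: Hom_def)
      moreover have "p \<cdot> (d \<cdot> u) = p \<cdot> x" "q \<cdot> (d \<cdot> u) = q \<cdot> x"
        using d e eq h comp_assoc[of u d p] comp_assoc[of u d q] by (auto simp: Hom_def)
      then have "d \<cdot> u = k" using k d by (auto simp: Hom_def)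
      ultimately show ?thesis by simp
    qed
    then show "\<exists>d. d \<in> hom (Cod A u) (Dom A q) \<and> d \<cdot> u = x \<and> q \<cdot> d = y"
      using d h by (auto simp: Hom_def)
  next
    fix u d d'
    assume u: "u \<in> S" and d: "d \<in> hom (Cod A u) (Dom A q)" "d' \<in> hom (Cod A u) (Dom A q)"
      and eq: "d \<cdot> u = d' \<cdot> u" "q \<cdot> d = q \<cdot> d'"
    have [simp]: "u \<in> Mor A" using S u by auto
    have "p \<cdot> d = p \<cdot> d'"
      by (rule orthogonal_unique[OF orthogonal_rlp u f])
        (use d eq h sq' in \<open>auto simp: Hom_def comp_assoc\<close>)
    then show "d = d'"
      using univ[of "p \<cdot> d" "Cod A u" "q \<cdot> d"] d h sq' eq by (auto simp: Hom_def)
  qed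
  then show ?thesis using h by (auto simp: rlp_def Hom_def)
qed

text \<open>Allows the apex of a pullback to be exchanged for an isomorphic object;
  \<open>M_ref_eq_rlp\<close> uses it to identify a naturality square with a known pullback.\<close>

lemma pullback_square_precomp_iso:
  assumes pb: "pullback_square p q f g" and e: "iso e" "Cod A e = Dom A p"
  shows "pullback_square (p \<cdot> e) (q \<cdot> e) f g"
proof -
  from pb obtain P X Y Z where h: "p \<in> hom P X" "q \<in> hom P Y" "f \<in> hom X Z" "g \<in> hom Y Z"
    and sq: "f \<cdot> p = g \<cdot> q"
    and univ: "\<And>W x y. \<lbrakk>x \<in> hom W X; y \<in> hom W Y; f \<cdot> x = g \<cdot> y\<rbrakk>
      \<Longrightarrow> \<exists>!d. d \<in> hom W P \<and> p \<cdot> d = x \<and> q \<cdot> d = y"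
    unfolding pullback_square_def by blast
  obtain i where [simp]: "e \<in> Mor A" and i: "i \<in> Mor A" "Dom A i = Cod A e" "Cod A i = Dom A e"
    "i \<cdot> e = Ident A (Dom A e)" "e \<cdot> i = Ident A (Cod A e)"
    using e(1) by (rule isoE)
  have ie: "i \<cdot> (e \<cdot> k) = k" if "k \<in> Mor A" "Cod A k = Dom A e" for k
    using comp_assoc[of k e i] that i by auto
  have ei: "e \<cdot> (i \<cdot> k) = k" if "k \<in> Mor A" "Cod A k = Cod A e" for k
    using comp_assoc[of k i e] that i by auto
  show ?thesis
    unfolding pullback_square_def
  proof (intro exI conjI allI ballI impI)
    show "p \<cdot> e \<in> hom (Dom A e) X" "q \<cdot> e \<in> hom (Dom A e) Y" "f \<in> hom X Z" "g \<in> hom Y Z"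
      using h e by (auto simp: Hom_def)
    show "f \<cdot> (p \<cdot> e) = g \<cdot> (q \<cdot> e)"
      using h sq e comp_assoc[of e p f] comp_assoc[of e q g] by (auto simp: Hom_def)
    fix W x y assume xy: "x \<in> hom W X" "y \<in> hom W Y" "f \<cdot> x = g \<cdot> y"
    from univ[OF this] obtain d where d: "d \<in> hom W P" "p \<cdot> d = x" "q \<cdot> d = y"
      and uniq: "\<And>d'. \<lbrakk>d' \<in> hom W P; p \<cdot> d' = x; q \<cdot> d' = y\<rbrakk> \<Longrightarrow> d' = d" by blast
    show "\<exists>!d. d \<in> hom W (Dom A e) \<and> (p \<cdot> e) \<cdot> d = x \<and> (q \<cdot> e) \<cdot> d = y"
    proof (rule ex1I[of _ "i \<cdot> d"])
      show "i \<cdot> d \<in> hom W (Dom A e) \<and> (p \<cdot> e) \<cdot> (i \<cdot> d) = x \<and> (q \<cdot> e) \<cdot> (i \<cdot> d) = y"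
        using d h e i ei by (auto simp: Hom_def comp_assoc)
      fix d' assume d': "d' \<in> hom W (Dom A e) \<and> (p \<cdot> e) \<cdot> d' = x \<and> (q \<cdot> e) \<cdot> d' = y"
      then have "e \<cdot> d' = d"
        using h e by (intro uniq) (auto simp: Hom_def comp_assoc)
      then show "d' = i \<cdot> d" using ie[of d'] d' by (auto simp: Hom_def)
    qed
  qed
qed

end

section \<open>The dual category\<close>

text \<open>The opposite category keeps the sets of objects and morphisms, so a class of morphisms
  of \<open>A\<close> is literally one of \<open>dual_cat A\<close>, and each coreflective statement
  is obtained by instantiating its reflective counterpart.\<close>

definition dual_cat :: "('o, 'm) cat \<Rightarrow> ('o, 'm) cat" where
  "dual_cat A = A\<lparr>Dom := Cod A, Cod := Dom A, Comp := (\<lambda>g f. f \<cdot>\<^bsub>A\<^esub> g)\<rparr>"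

lemma dual_cat_simps [simp]:
  "Ob (dual_cat A) = Ob A" "Mor (dual_cat A) = Mor A" "Dom (dual_cat A) = Cod A"
  "Cod (dual_cat A) = Dom A" "Ident (dual_cat A) = Ident A" "g \<cdot>\<^bsub>dual_cat A\<^esub> f = f \<cdot>\<^bsub>A\<^esub> g"
  by (simp_all add: dual_cat_def)

lemma Hom_dual_cat [simp]: "Hom (dual_cat A) X Y = Hom A Y X"
  by (auto simp: Hom_def)

lemma dual_dual_cat [simp]: "dual_cat (dual_cat A) = A"
  by (simp add: dual_cat_def)

lemma full_sub_dual_cat: "full_sub (dual_cat A) F = dual_cat (full_sub A F)"
  by (rule cat.equality) (auto simp: full_sub_def dual_cat_def)

lemma category_dual_cat: "category A \<Longrightarrow> category (dual_cat A)"
  unfolding category_def by (auto simp: Hom_def)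

lemma cat_functor_dual_cat:
  "cat_functor A B F \<Longrightarrow> cat_functor (dual_cat A) (dual_cat B) F"
  unfolding cat_functor_def cat_functor_axioms_def by (simp add: category_dual_cat) blast

lemma nat_transf_dual_cat:
  "nat_transf A B F G \<alpha> \<Longrightarrow> nat_transf (dual_cat A) (dual_cat B) G F \<alpha>"
  unfolding nat_transf_def nat_transf_axioms_def by (auto simp: cat_functor_dual_cat)

lemma adjunction_dual_cat:
  "adjunction A B L R \<eta> \<epsilon> \<Longrightarrow> adjunction (dual_cat B) (dual_cat A) R L \<epsilon> \<eta>"
  unfolding adjunction_def adjunction_axioms_def
  by (auto simp: cat_functor_dual_cat nat_transf_dual_cat)

section \<open>Classes determined by objects, and all notions read in the dual category\<close>

context category
begin

text \<open>\<open>local_isos\<close> and \<open>local_objects\<close> are the two sides of the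
  Galois connection between objects and morphisms given by unique extension. No reflector occurs in
  them, which is what makes the later classes independent of the chosen adjoints.\<close>

definition local_isos :: "'o set \<Rightarrow> 'm set" where
  "local_isos F = {f \<in> Mor A. \<forall>X \<in> F. \<forall>u \<in> hom (Dom A f) X. \<exists>!v. v \<in> hom (Cod A f) X \<and> v \<cdot> f = u}"

definition colocal_isos :: "'o set \<Rightarrow> 'm set" where
  "colocal_isos C = {f \<in> Mor A. \<forall>X \<in> C. \<forall>u \<in> hom X (Cod A f). \<exists>!v. v \<in> hom X (Dom A f) \<and> f \<cdot> v = u}"

definition local_objects :: "'m set \<Rightarrow> 'o set" where
  "local_objects S = {X \<in> Ob A. \<forall>f \<in> S. \<forall>u \<in> hom (Dom A f) X. \<exists>!v. v \<in> hom (Cod A f) X \<and> v \<cdot> f = u}"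

definition colocal_objects :: "'m set \<Rightarrow> 'o set" where
  "colocal_objects S = {X \<in> Ob A. \<forall>f \<in> S. \<forall>u \<in> hom X (Cod A f). \<exists>!v. v \<in> hom X (Dom A f) \<and> f \<cdot> v = u}"

interpretation dual: category "dual_cat A"
  by (rule category_dual_cat) (rule category_axioms)

lemma iso_dual: "category.iso (dual_cat A) f \<longleftrightarrow> iso f"
  unfolding iso_def dual.iso_def by auto

text \<open>Both square predicates list the span first and the cospan second; reversing the arrows
  exchanges the two, hence the permuted arguments.\<close>

lemma pushout_square_dual: "category.pushout_square (dual_cat A) p q f g \<longleftrightarrow> pullback_square f g p q"
  and pullback_square_dual: "category.pullback_square (dual_cat A) p q f g \<longleftrightarrow> pushout_square f g p q"
  unfolding dual.pushout_square_def pullback_square_def dual.pullback_square_def pushout_square_def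
  by (simp; (intro ex_cong1); blast)+

text \<open>Reconciles two conventions: \<open>semi_left_exact\<close> lists the approximation first
  in the cospan, whereas \<open>M_ref\<close> lists the reflected morphism first.\<close>

lemma pullback_square_sym: "pullback_square p q f g \<longleftrightarrow> pullback_square q p g f"
proof -
  have "pullback_square q p g f" if "pullback_square p q f g" for p q f g
  proof -
    from that obtain P X Y Z where "p \<in> hom P X" "q \<in> hom P Y" "f \<in> hom X Z" "g \<in> hom Y Z"
      "f \<cdot> p = g \<cdot> q"
      "\<And>W x y. \<lbrakk>x \<in> hom W X; y \<in> hom W Y; f \<cdot> x = g \<cdot> y\<rbrakk>
        \<Longrightarrow> \<exists>!d. d \<in> hom W P \<and> p \<cdot> d = x \<and> q \<cdot> d = y"
      unfolding pullback_square_def by blast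
    then show ?thesis
      unfolding pullback_square_def
      by (intro exI[of _ P] exI[of _ Y] exI[of _ X] exI[of _ Z]) (auto simp: conj_commute)
  qed
  then show ?thesis by blast
qed

lemma orthogonal_dual: "category.orthogonal (dual_cat A) S T \<longleftrightarrow> orthogonal T S"
proof -
  have "dual.comm_square u f x y \<longleftrightarrow> comm_square f u y x"
    "dual.is_lifting u f x y = is_lifting f u y x" for u f x y
    by (auto simp: dual.comm_square_def comm_square_def dual.is_lifting_def is_lifting_def fun_eq_iff)
  then show ?thesis
    unfolding dual.orthogonal_def orthogonal_def by simp blast
qed

lemma rlp_dual: "category.rlp (dual_cat A) S = llp S"
  and llp_dual: "category.llp (dual_cat A) S = rlp S"
  by (simp_all add: dual.rlp_def llp_def dual.llp_def rlp_def orthogonal_dual)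

lemma class_comp_dual: "category.class_comp (dual_cat A) S T = class_comp T S"
  unfolding dual.class_comp_def class_comp_def by auto metis+

lemma two_out_of_three_dual: "category.two_out_of_three (dual_cat A) W \<longleftrightarrow> two_out_of_three W"
  unfolding dual.two_out_of_three_def two_out_of_three_def by auto

lemma retract_closed_dual: "category.retract_closed (dual_cat A) W \<longleftrightarrow> retract_closed W"
proof -
  have "dual.comm_square f g s s' \<longleftrightarrow> comm_square g f s' s" for f g s s'
    unfolding dual.comm_square_def comm_square_def by auto
  then have "dual.retract_of f g \<longleftrightarrow> retract_of f g" for f g
    unfolding dual.retract_of_def retract_of_def by auto
  then show ?thesis
    by (simp add: dual.retract_closed_def retract_closed_def)
qed

lemma local_isos_dual: "category.local_isos (dual_cat A) F = colocal_isos F"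
  and local_objects_dual: "category.local_objects (dual_cat A) S = colocal_objects S"
  by (simp_all add: dual.local_isos_def colocal_isos_def dual.local_objects_def colocal_objects_def)

lemma left_strong_approx_dual:
  "category.left_strong_approx (dual_cat A) C f \<longleftrightarrow> right_strong_approx C f"
  by (simp add: dual.left_strong_approx_def right_strong_approx_def)

lemma semi_left_exact_dual: "category.semi_left_exact (dual_cat A) C \<longleftrightarrow> semi_right_exact C"
  by (simp add: dual.semi_left_exact_def semi_right_exact_def left_strong_approx_dual
      pullback_square_dual)

text \<open>Closure under isomorphism is phrased from domain to codomain, so the dual statement
  needs the inverse isomorphism.\<close>

lemma full_subcategory_dual: "category.full_subcategory (dual_cat A) F \<longleftrightarrow> full_subcategory F"
  unfolding dual.full_subcategory_def full_subcategory_def iso_dual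
  by simp (metis inverse_iso)

lemma reflection_dual: "category.reflection (dual_cat A) C t \<epsilon> \<longleftrightarrow> coreflection C t \<epsilon>"
  unfolding dual.reflection_def coreflection_def full_sub_dual_cat
  using adjunction_dual_cat[of "full_sub A C" A id_functor t _ \<epsilon>]
    adjunction_dual_cat[of "dual_cat A" "dual_cat (full_sub A C)" t id_functor \<epsilon>] by auto

lemma reflective_dual: "category.reflective (dual_cat A) C \<longleftrightarrow> coreflective C"
  by (simp add: dual.reflective_def coreflective_def reflection_dual full_subcategory_dual)

lemma E_ref_dual: "category.E_ref (dual_cat A) t = M_coref t"
  by (simp add: dual.E_ref_def M_coref_def iso_dual)

lemma M_ref_dual: "category.M_ref (dual_cat A) t \<epsilon> = E_coref t \<epsilon>"
  by (simp add: dual.M_ref_def E_coref_def pullback_square_dual[symmetric]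
      category.pullback_square_sym[OF dual.category_axioms, of _ _ "FMor t _"])

end

section \<open>Reflective subcategories and factorization systems\<close>

context category
begin

section \<open>Calculus of local isomorphisms\<close>

lemma local_isos_ex:
  assumes "f \<in> local_isos F" "X \<in> F" "u \<in> hom (Dom A f) X"
  obtains v where "v \<in> hom (Cod A f) X" "v \<cdot> f = u"
  using assms unfolding local_isos_def by blast

lemma local_isos_unique:
  assumes "f \<in> local_isos F" "X \<in> F" "v \<in> hom (Cod A f) X" "v' \<in> hom (Cod A f) X"
    "v \<cdot> f = v' \<cdot> f"
  shows "v = v'"
proof -
  have "v' \<cdot> f \<in> hom (Dom A f) X" using assms by (auto simp: local_isos_def Hom_def)
  then show ?thesis using assms unfolding local_isos_def by blast
qed

lemma local_isosI:
  assumes "f \<in> Mor A"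
    and "\<And>X u. \<lbrakk>X \<in> F; u \<in> hom (Dom A f) X\<rbrakk> \<Longrightarrow> \<exists>v. v \<in> hom (Cod A f) X \<and> v \<cdot> f = u"
    and "\<And>X v v'. \<lbrakk>X \<in> F; v \<in> hom (Cod A f) X; v' \<in> hom (Cod A f) X; v \<cdot> f = v' \<cdot> f\<rbrakk> \<Longrightarrow> v = v'"
  shows "f \<in> local_isos F"
  unfolding local_isos_def
proof (intro CollectI conjI ballI)
  fix X u assume "X \<in> F" "u \<in> hom (Dom A f) X"
  then show "\<exists>!v. v \<in> hom (Cod A f) X \<and> v \<cdot> f = u"
    using assms(2)[of X u] assms(3)[of X] by metis
qed (rule assms)

lemma local_isos_subset_Mor: "local_isos F \<subseteq> Mor A"
  by (auto simp: local_isos_def)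

lemma left_strong_approx_iff: "left_strong_approx F u \<longleftrightarrow> u \<in> local_isos F \<and> Cod A u \<in> F"
  by (auto simp: left_strong_approx_def local_isos_def)

lemma iso_in_local_isos:
  assumes "iso f" shows "f \<in> local_isos F"
proof -
  obtain g where [simp]: "f \<in> Mor A" and g: "g \<in> Mor A" "Dom A g = Cod A f" "Cod A g = Dom A f"
    "g \<cdot> f = Ident A (Dom A f)" "f \<cdot> g = Ident A (Cod A f)"
    using assms by (rule isoE)
  show ?thesis
  proof (rule local_isosI)
    fix X u assume "u \<in> hom (Dom A f) X"
    then show "\<exists>v. v \<in> hom (Cod A f) X \<and> v \<cdot> f = u"
      using g by (intro exI[of _ "u \<cdot> g"]) (auto simp: Hom_def comp_assoc)
  next
    fix X v v' assume v: "v \<in> hom (Cod A f) X" "v' \<in> hom (Cod A f) X" and eq: "v \<cdot> f = v' \<cdot> f"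
    have "(v \<cdot> f) \<cdot> g = v" "(v' \<cdot> f) \<cdot> g = v'" using v g by (auto simp: Hom_def comp_assoc)
    then show "v = v'" using eq by metis
  qed simp
qed

text \<open>A morphism is a local isomorphism when precomposition with it is bijective on maps into
  each object of \<open>F\<close>, and bijections have the two-out-of-three property. The proof
  spells this out without hom-set functions.\<close>

lemma two_out_of_three_local_isos: "two_out_of_three (local_isos F)"
  unfolding two_out_of_three_def
proof (intro ballI impI conjI; (elim conjE)?)
  fix f g
  assume [simp]: "f \<in> Mor A" "g \<in> Mor A" and fg: "Cod A f = Dom A g"
  {
    assume f: "f \<in> local_isos F" and g: "g \<in> local_isos F"
    show "g \<cdot> f \<in> local_isos F"
    proof (rule local_isosI)
      fix X u assume X: "X \<in> F" and u: "u \<in> hom (Dom A (g \<cdot> f)) X"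
      obtain v where v: "v \<in> hom (Cod A f) X" "v \<cdot> f = u"
        using local_isos_ex[OF f X, of u] u fg by auto
      obtain w where w: "w \<in> hom (Cod A g) X" "w \<cdot> g = v"
        using local_isos_ex[OF g X, of v] v fg by auto
      show "\<exists>v. v \<in> hom (Cod A (g \<cdot> f)) X \<and> v \<cdot> (g \<cdot> f) = u"
        using v w fg comp_assoc[of f g w] by (auto simp: Hom_def)
    next
      fix X v v' assume X: "X \<in> F" and v: "v \<in> hom (Cod A (g \<cdot> f)) X" "v' \<in> hom (Cod A (g \<cdot> f)) X"
        and eq: "v \<cdot> (g \<cdot> f) = v' \<cdot> (g \<cdot> f)"
      have "v \<cdot> g = v' \<cdot> g"
        by (rule local_isos_unique[OF f X]) (use v eq fg in \<open>auto simp: Hom_def comp_assoc\<close>)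
      then show "v = v'"
        by (rule local_isos_unique[OF g X, rotated 2]) (use v fg in auto)
    qed (use fg in simp)
  }
  {
    assume f: "f \<in> local_isos F" and gf: "g \<cdot> f \<in> local_isos F"
    show "g \<in> local_isos F"
    proof (rule local_isosI)
      fix X u assume X: "X \<in> F" and u: "u \<in> hom (Dom A g) X"
      obtain w where w: "w \<in> hom (Cod A g) X" "w \<cdot> (g \<cdot> f) = u \<cdot> f"
        using local_isos_ex[OF gf X, of "u \<cdot> f"] u fg by (auto simp: Hom_def)
      have "w \<cdot> g = u"
        by (rule local_isos_unique[OF f X]) (use u w fg in \<open>auto simp: Hom_def comp_assoc\<close>)
      then show "\<exists>v. v \<in> hom (Cod A g) X \<and> v \<cdot> g = u" using w by auto
    next
      fix X v v' assume X: "X \<in> F" and v: "v \<in> hom (Cod A g) X" "v' \<in> hom (Cod A g) X"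
        and eq: "v \<cdot> g = v' \<cdot> g"
      have "(v \<cdot> g) \<cdot> f = (v' \<cdot> g) \<cdot> f" using eq by simp
      then show "v = v'"
        using v fg by (intro local_isos_unique[OF gf X, of v v']) (auto simp: Hom_def comp_assoc)
    qed simp
  }
  {
    assume g: "g \<in> local_isos F" and gf: "g \<cdot> f \<in> local_isos F"
    show "f \<in> local_isos F"
    proof (rule local_isosI)
      fix X u assume X: "X \<in> F" and u: "u \<in> hom (Dom A f) X"
      obtain w where w: "w \<in> hom (Cod A g) X" "w \<cdot> (g \<cdot> f) = u"
        using local_isos_ex[OF gf X, of u] u fg by (auto simp: Hom_def)
      then show "\<exists>v. v \<in> hom (Cod A f) X \<and> v \<cdot> f = u"
        using fg by (intro exI[of _ "w \<cdot> g"]) (auto simp: Hom_def comp_assoc)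
    next
      fix X v v' assume X: "X \<in> F" and v: "v \<in> hom (Cod A f) X" "v' \<in> hom (Cod A f) X"
        and eq: "v \<cdot> f = v' \<cdot> f"
      \<comment> \<open>Extending both maps along \<open>g\<close> turns the hypothesis into an
        equation over \<open>g \<cdot> f\<close>, where cancellation is available.\<close>
      obtain w where w: "w \<in> hom (Cod A g) X" "w \<cdot> g = v"
        using local_isos_ex[OF g X, of v] v fg by auto
      obtain w' where w': "w' \<in> hom (Cod A g) X" "w' \<cdot> g = v'"
        using local_isos_ex[OF g X, of v'] v fg by auto
      have "w \<cdot> (g \<cdot> f) = w' \<cdot> (g \<cdot> f)"
        using w w' eq fg comp_assoc[of f g w] comp_assoc[of f g w'] by (auto simp: Hom_def)
      then have "w = w'"
        using w w' fg by (intro local_isos_unique[OF gf X, of w w']) (auto simp: Hom_def)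
      then show "v = v'" using w w' by simp
    qed simp
  }
qed

text \<open>The diagonal is the extension of \<open>x\<close> along \<open>u\<close>, which exists
  as \<open>Dom A f\<close> lies in \<open>F\<close>; the lower triangle follows from uniqueness of
  extensions into \<open>Cod A f\<close>.\<close>

lemma orthogonal_local_isos:
  assumes F: "\<And>g. g \<in> T \<Longrightarrow> g \<in> Mor A \<and> Dom A g \<in> F \<and> Cod A g \<in> F"
  shows "orthogonal (local_isos F) T"
proof (rule orthogonalI)
  fix u f x y
  assume u: "u \<in> local_isos F" and f: "f \<in> T" and x: "x \<in> hom (Dom A u) (Dom A f)"
    and y: "y \<in> hom (Cod A u) (Cod A f)" and eq: "f \<cdot> x = y \<cdot> u"
  have [simp]: "u \<in> Mor A" "f \<in> Mor A" and fF: "Dom A f \<in> F" "Cod A f \<in> F"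
    using u F[OF f] local_isos_subset_Mor by auto
  obtain d where d: "d \<in> hom (Cod A u) (Dom A f)" "d \<cdot> u = x"
    using local_isos_ex[OF u fF(1) x] by blast
  have "f \<cdot> d = y"
    by (rule local_isos_unique[OF u fF(2)]) (use d x y eq in \<open>auto simp: Hom_def comp_assoc\<close>)
  then show "\<exists>d. d \<in> hom (Cod A u) (Dom A f) \<and> d \<cdot> u = x \<and> f \<cdot> d = y" using d by blast
next
  fix u f d d'
  assume "u \<in> local_isos F" "f \<in> T" "d \<in> hom (Cod A u) (Dom A f)" "d' \<in> hom (Cod A u) (Dom A f)"
    "d \<cdot> u = d' \<cdot> u"
  then show "d = d'" using F local_isos_unique[of u F "Dom A f" d d'] by blast
qed

text \<open>Such a morphism lies on both sides of \<open>orthogonal_local_isos\<close>, hence is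
  orthogonal to itself.\<close>

lemma iso_of_local_iso:
  assumes "f \<in> local_isos F" "Dom A f \<in> F" "Cod A f \<in> F"
  shows "iso f"
proof (rule iso_of_orthogonal_self)
  show "f \<in> Mor A" using assms local_isos_subset_Mor by auto
  then have "orthogonal (local_isos F) {f}" using assms by (intro orthogonal_local_isos) auto
  then show "orthogonal {f} {f}" using assms by (auto intro: orthogonal_mono)
qed

section \<open>Two-out-of-three and orthogonal factorization systems\<close>

lemma two_out_of_threeD:
  assumes "two_out_of_three W" "f \<in> Mor A" "g \<in> Mor A" "Cod A f = Dom A g"
  shows "\<lbrakk>f \<in> W; g \<in> W\<rbrakk> \<Longrightarrow> g \<cdot> f \<in> W" "\<lbrakk>f \<in> W; g \<cdot> f \<in> W\<rbrakk> \<Longrightarrow> g \<in> W"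
    "\<lbrakk>g \<in> W; g \<cdot> f \<in> W\<rbrakk> \<Longrightarrow> f \<in> W"
  using assms unfolding two_out_of_three_def by blast+

text \<open>Encoded by mutual complementarity and existence of factorizations; orthogonality,
  containment in \<open>Mor A\<close> and the closure properties of both classes are consequences of
  complementarity.\<close>

definition factorization_system :: "'m set \<Rightarrow> 'm set \<Rightarrow> bool" where
  "factorization_system E M \<longleftrightarrow> llp M = E \<and> rlp E = M \<and> Mor A \<subseteq> class_comp M E"

text \<open>If \<open>f \<in> rlp E\<close> factors as \<open>m \<cdot> e\<close>, then
  \<open>e\<close> is orthogonal to both \<open>m\<close> and \<open>m \<cdot> e\<close>, hence
  invertible, and \<open>f\<close> lies in \<open>M\<close> by closure under isomorphisms. The other
  complement is treated dually.\<close>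

lemma factorization_systemI:
  assumes E: "E \<subseteq> Mor A" and M: "M \<subseteq> Mor A" and o: "orthogonal E M"
    and fact: "Mor A \<subseteq> class_comp M E"
    and ME: "\<And>e m. \<lbrakk>e \<in> Mor A; iso e; m \<in> M; Cod A e = Dom A m\<rbrakk> \<Longrightarrow> m \<cdot> e \<in> M"
    and EM: "\<And>e m. \<lbrakk>m \<in> Mor A; iso m; e \<in> E; Cod A e = Dom A m\<rbrakk> \<Longrightarrow> m \<cdot> e \<in> E"
  shows "factorization_system E M"
proof -
  have "f \<in> M" if f: "f \<in> rlp E" for f
  proof -
    have [simp]: "f \<in> Mor A" using f rlp_subset_Mor by auto
    then have "f \<in> class_comp M E" using fact by blast
    then obtain m e where me: "f = m \<cdot> e" "e \<in> E" "m \<in> M" "Cod A e = Dom A m"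
      unfolding class_comp_def by blast
    have [simp]: "e \<in> Mor A" "m \<in> Mor A" using me E M by auto
    have "iso e"
    proof (rule iso_of_orthogonal_factorization[of e m])
      show "orthogonal {e} {m}" using me o by (auto intro: orthogonal_mono)
      show "orthogonal {e} {m \<cdot> e}" using me f orthogonal_rlp[of E] by (auto intro: orthogonal_mono)
    qed (use me in auto)
    then show ?thesis using me ME by auto
  qed
  moreover have "f \<in> E" if f: "f \<in> llp M" for f
  proof -
    \<comment> \<open>In the dual category \<open>m\<close> is the first factor of \<open>f\<close>,
      so the same criterion makes \<open>m\<close> invertible.\<close>
    interpret dual: category "dual_cat A"
      by (rule category_dual_cat) (rule category_axioms)
    have [simp]: "f \<in> Mor A" using f llp_subset_Mor by auto
    then have "f \<in> class_comp M E" using fact by blast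
    then obtain m e where me: "f = m \<cdot> e" "e \<in> E" "m \<in> M" "Cod A e = Dom A m"
      unfolding class_comp_def by blast
    have [simp]: "e \<in> Mor A" "m \<in> Mor A" using me E M by auto
    have "dual.iso m"
    proof (rule dual.iso_of_orthogonal_factorization[of m e])
      show "dual.orthogonal {m} {e}"
        using me o by (auto simp: orthogonal_dual intro: orthogonal_mono)
      show "dual.orthogonal {m} {e \<cdot>\<^bsub>dual_cat A\<^esub> m}"
        using me f orthogonal_llp[of M] by (auto simp: orthogonal_dual intro: orthogonal_mono)
    qed (use me in auto)
    then show ?thesis using me EM by (auto simp: iso_dual)
  qed
  ultimately show ?thesis
    using subset_rlp[OF o M] subset_llp[OF o E] fact by (auto simp: factorization_system_def)
qed

section \<open>Reflections as adjunctions and as universal arrows\<close>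

lemma Hom_full_sub: "Hom (full_sub A F) X Y = {f \<in> hom X Y. X \<in> F \<and> Y \<in> F}"
  by (auto simp: Hom_def full_sub_def)

lemma full_sub_simps: "Ob (full_sub A F) = F" "Comp (full_sub A F) = Comp A"
  "Ident (full_sub A F) = Ident A"
  by (simp_all add: full_sub_def)

text \<open>Everything later needs from the adjunction. The unit is a universal arrow:
  \<open>u\<close> extends along it as \<open>\<epsilon> Y \<cdot> FMor r u\<close>.\<close>

lemma
  assumes F: "F \<subseteq> Ob A" and r: "reflection F r \<eta>"
  shows reflection_FOb: "X \<in> Ob A \<Longrightarrow> FOb r X \<in> F"
    and reflection_unit: "X \<in> Ob A \<Longrightarrow> \<eta> X \<in> hom X (FOb r X)"
    and reflection_unit_local_iso: "X \<in> Ob A \<Longrightarrow> \<eta> X \<in> local_isos F"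
    and reflection_FMor: "f \<in> hom X Y \<Longrightarrow> FMor r f \<in> hom (FOb r X) (FOb r Y)"
    and reflection_natural: "f \<in> hom X Y \<Longrightarrow> FMor r f \<cdot> \<eta> X = \<eta> Y \<cdot> f"
proof -
  obtain \<epsilon> where "adjunction A (full_sub A F) r id_functor \<eta> \<epsilon>"
    using r by (auto simp: reflection_def)
  then interpret adj: adjunction A "full_sub A F" r id_functor \<eta> \<epsilon> .
  have FOb: "FOb r X \<in> F" if "X \<in> Ob A" for X
    using adj.L.FOb_in_Ob[OF that] by (simp add: full_sub_simps)
  have unit: "\<eta> X \<in> hom X (FOb r X)" if "X \<in> Ob A" for X
    using adj.unit.component_in_Hom[OF that] by (simp add: id_functor_def comp_functor_def)
  have FMor: "FMor r f \<in> hom (FOb r X) (FOb r Y)" if "f \<in> hom X Y" for f X Y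
    using adj.L.FMor_in_Hom[OF that] by (simp add: Hom_full_sub)
  have nat: "FMor r f \<cdot> \<eta> X = \<eta> Y \<cdot> f" if "f \<in> hom X Y" for f X Y
    using adj.unit.naturality[OF that] by (simp add: id_functor_def comp_functor_def)
  have counit: "\<epsilon> Y \<in> hom (FOb r Y) Y" if "Y \<in> F" for Y
    using adj.counit.component_in_Hom[of Y] that
    by (simp add: id_functor_def comp_functor_def full_sub_simps Hom_full_sub)
  have cnat: "f \<cdot> \<epsilon> X = \<epsilon> Y \<cdot> FMor r f" if "f \<in> hom X Y" "X \<in> F" "Y \<in> F" for f X Y
    using adj.counit.naturality[of f X Y] that
    by (simp add: id_functor_def comp_functor_def full_sub_simps Hom_full_sub)
  have tri: "\<epsilon> (FOb r X) \<cdot> FMor r (\<eta> X) = Ident A (FOb r X)" if "X \<in> Ob A" for X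
    using adj.triangle_L[OF that] by (simp add: full_sub_simps)
  have tri': "\<epsilon> Y \<cdot> \<eta> Y = Ident A Y" if "Y \<in> F" for Y
    using adj.triangle_R[of Y] that by (simp add: full_sub_simps id_functor_def)
  have "\<eta> X \<in> local_isos F" if X: "X \<in> Ob A" for X
  proof (rule local_isosI)
    show "\<eta> X \<in> Mor A" using unit[OF X] by (simp add: Hom_def)
  next
    fix Y u assume Y: "Y \<in> F" and u: "u \<in> hom (Dom A (\<eta> X)) Y"
    have YO: "Y \<in> Ob A" using Y F by auto
    have u: "u \<in> hom X Y" using u unit[OF X] by (simp add: Hom_def)
    have "(\<epsilon> Y \<cdot> FMor r u) \<cdot> \<eta> X = \<epsilon> Y \<cdot> (\<eta> Y \<cdot> u)"
      using Comp_assoc[OF unit[OF X] FMor[OF u] counit[OF Y]] nat[OF u] by simp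
    also have "\<dots> = u"
      using Comp_assoc[OF u unit[OF YO] counit[OF Y]] tri'[OF Y] u by (simp add: Hom_def)
    finally show "\<exists>v. v \<in> hom (Cod A (\<eta> X)) Y \<and> v \<cdot> \<eta> X = u"
      using Comp_in_Hom[OF FMor[OF u] counit[OF Y]] unit[OF X] by (auto simp: Hom_def)
  next
    \<comment> \<open>For uniqueness, a map out of \<open>FOb r X\<close> is recovered from its
      composite with \<open>\<eta> X\<close>, by the triangle identity for \<open>r\<close> and
      naturality of the counit.\<close>
    have *: "v = \<epsilon> Y \<cdot> FMor r (v \<cdot> \<eta> X)" if Y: "Y \<in> F" and v: "v \<in> hom (FOb r X) Y" for Y v
    proof -
      have "v = v \<cdot> (\<epsilon> (FOb r X) \<cdot> FMor r (\<eta> X))"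
        using tri[OF X] v by (simp add: Hom_def)
      also have "\<dots> = (v \<cdot> \<epsilon> (FOb r X)) \<cdot> FMor r (\<eta> X)"
        using Comp_assoc[OF FMor[OF unit[OF X]] counit[OF FOb[OF X]] v] by simp
      also have "\<dots> = (\<epsilon> Y \<cdot> FMor r v) \<cdot> FMor r (\<eta> X)"
        using cnat[OF v FOb[OF X] Y] by simp
      also have "\<dots> = \<epsilon> Y \<cdot> (FMor r v \<cdot> FMor r (\<eta> X))"
        using Comp_assoc[OF FMor[OF unit[OF X]] FMor[OF v] counit[OF Y]] by simp
      also have "\<dots> = \<epsilon> Y \<cdot> FMor r (v \<cdot> \<eta> X)"
        using adj.L.FMor_Comp[OF unit[OF X] v] by (simp add: full_sub_simps)
      finally show ?thesis .
    qed
    fix Y v v' assume "Y \<in> F" "v \<in> hom (Cod A (\<eta> X)) Y" "v' \<in> hom (Cod A (\<eta> X)) Y"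
      and "v \<cdot> \<eta> X = v' \<cdot> \<eta> X"
    then show "v = v'" using *[of Y v] *[of Y v'] unit[OF X] by (simp add: Hom_def)
  qed
  then show "X \<in> Ob A \<Longrightarrow> FOb r X \<in> F" "X \<in> Ob A \<Longrightarrow> \<eta> X \<in> hom X (FOb r X)"
    "X \<in> Ob A \<Longrightarrow> \<eta> X \<in> local_isos F" "f \<in> hom X Y \<Longrightarrow> FMor r f \<in> hom (FOb r X) (FOb r Y)"
    "f \<in> hom X Y \<Longrightarrow> FMor r f \<cdot> \<eta> X = \<eta> Y \<cdot> f"
    using FOb unit FMor nat by auto
qed

text \<open>The converse passage: chosen universal arrows assemble into an adjunction.
  Functoriality, naturality of the counit and the first triangle identity are each checked after
  precomposing with \<open>\<eta> X\<close>, which \<open>uniq\<close> allows.\<close>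

lemma reflection_ex:
  assumes F: "F \<subseteq> Ob A"
    and approx: "\<And>X. X \<in> Ob A \<Longrightarrow> \<exists>u. left_strong_approx F u \<and> Dom A u = X"
  shows "\<exists>r \<eta>. reflection F r \<eta>"
proof -
  obtain \<eta> where \<eta>: "\<And>X. X \<in> Ob A \<Longrightarrow> left_strong_approx F (\<eta> X) \<and> Dom A (\<eta> X) = X"
    using approx by metis
  define R where "R X = Cod A (\<eta> X)" for X
  have RF: "R X \<in> F" and hom_\<eta>: "\<eta> X \<in> hom X (R X)" and iso_\<eta>: "\<eta> X \<in> local_isos F"
    if "X \<in> Ob A" for X
    using \<eta>[OF that] local_isos_subset_Mor by (auto simp: left_strong_approx_iff R_def Hom_def)
  have RO: "R X \<in> Ob A" if "X \<in> Ob A" for X using RF[OF that] F by auto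
  have uniq: "v = v'" if "X \<in> Ob A" "Y \<in> F" "v \<in> hom (R X) Y" "v' \<in> hom (R X) Y"
    "v \<cdot> \<eta> X = v' \<cdot> \<eta> X" for X Y v v'
    using local_isos_unique[OF iso_\<eta>[OF that(1)] that(2)] that(3-) by (auto simp: R_def)
  \<comment> \<open>\<open>e X Y u\<close> is the extension of \<open>u\<close> along
    \<open>\<eta> X\<close>. Below, \<open>G\<close> is its instance giving the reflector on
    morphisms, and \<open>c\<close>, the extension of an identity, is the counit.\<close>
  define e where "e X Y u = (SOME v. v \<in> hom (R X) Y \<and> v \<cdot> \<eta> X = u)" for X Y u
  have e: "e X Y u \<in> hom (R X) Y \<and> e X Y u \<cdot> \<eta> X = u" if "X \<in> Ob A" "Y \<in> F" "u \<in> hom X Y" for X Y u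
    unfolding e_def
    by (rule someI_ex, rule local_isos_ex[OF iso_\<eta>[OF that(1)] that(2), of u])
      (use that \<eta> in \<open>auto simp: R_def\<close>)
  define G where "G f = e (Dom A f) (R (Cod A f)) (\<eta> (Cod A f) \<cdot> f)" for f
  have G: "G f \<in> hom (R X) (R Y)" "G f \<cdot> \<eta> X = \<eta> Y \<cdot> f" if "f \<in> hom X Y" for f X Y
  proof -
    have XY: "X \<in> Ob A" "Y \<in> Ob A" using Hom_Ob[OF that] by auto
    have "G f \<in> hom (R X) (R Y) \<and> G f \<cdot> \<eta> X = \<eta> Y \<cdot> f"
      using e[OF XY(1) RF[OF XY(2)] Comp_in_Hom[OF that hom_\<eta>[OF XY(2)]]] that
      by (simp add: G_def Hom_def)
    then show "G f \<in> hom (R X) (R Y)" "G f \<cdot> \<eta> X = \<eta> Y \<cdot> f" by auto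
  qed
  define c where "c Y = e Y Y (Ident A Y)" for Y
  have c: "c Y \<in> hom (R Y) Y" "c Y \<cdot> \<eta> Y = Ident A Y" if "Y \<in> F" for Y
    using e[of Y Y "Ident A Y"] that F Ident_in_Hom[of Y] by (auto simp: c_def)
  define r where "r = \<lparr>FOb = R, FMor = G\<rparr>"
  have S: "category (full_sub A F)" by (rule category_full_sub[OF F])
  have I: "cat_functor (full_sub A F) A id_functor" by (rule inclusion_functor[OF F])
  have GI: "G (Ident A X) = Ident A (R X)" if X: "X \<in> Ob A" for X
    by (rule uniq[OF X RF[OF X]])
      (use G[OF Ident_in_Hom[OF X]] Ident_in_Hom[OF RO[OF X]] hom_\<eta>[OF X] RO[OF X] in \<open>auto simp: Hom_def\<close>)
  have GC: "G (g \<cdot> f) = G g \<cdot> G f" if f: "f \<in> hom X Y" and g: "g \<in> hom Y Z" for f g X Y Z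
  proof -
    have O: "X \<in> Ob A" "Y \<in> Ob A" "Z \<in> Ob A" using Hom_Ob[OF f] Hom_Ob[OF g] by auto
    have "(G g \<cdot> G f) \<cdot> \<eta> X = G g \<cdot> (\<eta> Y \<cdot> f)"
      using Comp_assoc[OF hom_\<eta>[OF O(1)] G(1)[OF f] G(1)[OF g]] G(2)[OF f] by simp
    also have "\<dots> = (\<eta> Z \<cdot> g) \<cdot> f"
      using Comp_assoc[OF f hom_\<eta>[OF O(2)] G(1)[OF g]] G(2)[OF g] by simp
    also have "\<dots> = G (g \<cdot> f) \<cdot> \<eta> X"
      using Comp_assoc[OF f g hom_\<eta>[OF O(3)]] G(2)[OF Comp_in_Hom[OF f g]] by simp
    finally show ?thesis
      using uniq[OF O(1) RF[OF O(3)] G(1)[OF Comp_in_Hom[OF f g]] Comp_in_Hom[OF G(1)[OF f] G(1)[OF g]]]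
      by simp
  qed
  have L: "cat_functor A (full_sub A F) r"
    using S category_axioms RF G GI GC Hom_Ob
    unfolding cat_functor_def cat_functor_axioms_def
    by (simp add: r_def full_sub_simps Hom_full_sub)
  have cnat: "f \<cdot> c X = c Y \<cdot> G f" if f: "f \<in> hom X Y" and X: "X \<in> F" and Y: "Y \<in> F" for f X Y
  proof -
    have O: "X \<in> Ob A" "Y \<in> Ob A" using Hom_Ob[OF f] by auto
    have "(f \<cdot> c X) \<cdot> \<eta> X = f"
      using Comp_assoc[OF hom_\<eta>[OF O(1)] c(1)[OF X] f] c(2)[OF X] Comp_Ident_right[OF f] by simp
    also have "\<dots> = c Y \<cdot> (\<eta> Y \<cdot> f)"
      using Comp_assoc[OF f hom_\<eta>[OF O(2)] c(1)[OF Y]] c(2)[OF Y] Comp_Ident_left[OF f] by simp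
    also have "\<dots> = (c Y \<cdot> G f) \<cdot> \<eta> X"
      using Comp_assoc[OF hom_\<eta>[OF O(1)] G(1)[OF f] c(1)[OF Y]] G(2)[OF f] by simp
    finally show ?thesis
      using uniq[OF O(1) Y Comp_in_Hom[OF c(1)[OF X] f] Comp_in_Hom[OF G(1)[OF f] c(1)[OF Y]]] by simp
  qed
  have tri: "c (R X) \<cdot> G (\<eta> X) = Ident A (R X)" if X: "X \<in> Ob A" for X
  proof -
    have "(c (R X) \<cdot> G (\<eta> X)) \<cdot> \<eta> X = c (R X) \<cdot> (\<eta> (R X) \<cdot> \<eta> X)"
      using Comp_assoc[OF hom_\<eta>[OF X] G(1)[OF hom_\<eta>[OF X]] c(1)[OF RF[OF X]]] G(2)[OF hom_\<eta>[OF X]]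
      by simp
    also have "\<dots> = Ident A (R X) \<cdot> \<eta> X"
      using Comp_assoc[OF hom_\<eta>[OF X] hom_\<eta>[OF RO[OF X]] c(1)[OF RF[OF X]]] c(2)[OF RF[OF X]] by simp
    finally show ?thesis
      using uniq[OF X RF[OF X] Comp_in_Hom[OF G(1)[OF hom_\<eta>[OF X]] c(1)[OF RF[OF X]]]
          Ident_in_Hom[OF RO[OF X]]] by simp
  qed
  have id: "cat_functor B B id_functor" if "category B" for B :: "('o, 'm) cat"
    using that unfolding cat_functor_def cat_functor_axioms_def id_functor_def by simp
  \<comment> \<open>\<open>nat_transf\<close> presupposes that its source and target are functors,
    so both composites of \<open>r\<close> with the inclusion are verified first.\<close>
  have RL: "cat_functor A A (comp_functor id_functor r)"
    using category_axioms RO G GI GC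
    unfolding cat_functor_def cat_functor_axioms_def
    by (simp add: r_def comp_functor_def id_functor_def)
  have LR: "cat_functor (full_sub A F) (full_sub A F) (comp_functor r id_functor)"
    using S RF G GI GC F
    unfolding cat_functor_def cat_functor_axioms_def
    by (simp add: r_def full_sub_simps Hom_full_sub comp_functor_def id_functor_def subset_iff) blast
  have "nat_transf A A id_functor (comp_functor id_functor r) \<eta>"
    using RL id[OF category_axioms] hom_\<eta> G
    unfolding nat_transf_def nat_transf_axioms_def
    by (simp add: r_def comp_functor_def id_functor_def)
  moreover have "nat_transf (full_sub A F) (full_sub A F) (comp_functor r id_functor) id_functor c"
    using LR id[OF S] c cnat RF F
    unfolding nat_transf_def nat_transf_axioms_def
    by (auto simp: r_def comp_functor_def id_functor_def full_sub_simps Hom_full_sub)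
  moreover have "adjunction_axioms A (full_sub A F) r id_functor \<eta> c"
    using tri c unfolding adjunction_axioms_def
    by (simp add: r_def id_functor_def full_sub_simps)
  ultimately have "adjunction A (full_sub A F) r id_functor \<eta> c"
    using L I unfolding adjunction_def by blast
  then show ?thesis unfolding reflection_def by blast
qed

lemma reflector_reflection:
  assumes "reflective F"
  shows "case reflector F of (r, \<eta>) \<Rightarrow> reflection F r \<eta>"
proof -
  have "\<exists>x. case x of (r, \<eta>) \<Rightarrow> reflection F r \<eta>"
    using assms by (auto simp: reflective_def)
  then show ?thesis unfolding reflector_def by (rule someI_ex)
qed

lemma coreflector_coreflection:
  assumes "coreflective C"
  shows "case coreflector C of (t, \<epsilon>) \<Rightarrow> coreflection C t \<epsilon>"
proof -
  have "\<exists>x. case x of (t, \<epsilon>) \<Rightarrow> coreflection C t \<epsilon>"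
    using assms by (auto simp: coreflective_def)
  then show ?thesis unfolding coreflector_def by (rule someI_ex)
qed

section \<open>The factorization system of a semi-left-exact reflection\<close>

lemma two_out_of_three_iff:
  assumes "two_out_of_three W" "f \<in> Mor A" "g \<in> Mor A" "Cod A f = Dom A g"
  shows "f \<in> W \<Longrightarrow> g \<cdot> f \<in> W \<longleftrightarrow> g \<in> W" "g \<in> W \<Longrightarrow> g \<cdot> f \<in> W \<longleftrightarrow> f \<in> W"
  using two_out_of_threeD[OF assms] by blast+

text \<open>In the naturality square of the unit both units are local isomorphisms, so
  two-out-of-three passes the property between \<open>f\<close> and \<open>FMor r f\<close>; for the
  latter, a morphism between objects of \<open>F\<close>, it means invertibility.\<close>

lemma E_ref_eq_local_isos:
  assumes F: "F \<subseteq> Ob A" and r: "reflection F r \<eta>"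
  shows "E_ref r = local_isos F"
proof -
  have "iso (FMor r f) \<longleftrightarrow> f \<in> local_isos F" if f[simp]: "f \<in> Mor A" for f
  proof -
    let ?X = "Dom A f" and ?Y = "Cod A f"
    have f': "f \<in> hom ?X ?Y" by (simp add: Hom_def)
    note rf = reflection_FMor[OF F r f'] and nat = reflection_natural[OF F r f']
    have u: "\<eta> ?X \<in> hom ?X (FOb r ?X)" "\<eta> ?Y \<in> hom ?Y (FOb r ?Y)"
      using reflection_unit[OF F r] by auto
    have l: "\<eta> ?X \<in> local_isos F" "\<eta> ?Y \<in> local_isos F" "FOb r ?X \<in> F" "FOb r ?Y \<in> F"
      using reflection_unit_local_iso[OF F r] reflection_FOb[OF F r] by auto
    have "iso (FMor r f) \<longleftrightarrow> FMor r f \<in> local_isos F"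
      using iso_in_local_isos iso_of_local_iso[of "FMor r f" F] rf l by (auto simp: Hom_def)
    also have "\<dots> \<longleftrightarrow> FMor r f \<cdot> \<eta> ?X \<in> local_isos F"
      by (rule two_out_of_three_iff(1)[OF two_out_of_three_local_isos, symmetric])
        (use l u rf in \<open>auto simp: Hom_def\<close>)
    also have "\<dots> \<longleftrightarrow> f \<in> local_isos F"
      unfolding nat
      by (rule two_out_of_three_iff(2)[OF two_out_of_three_local_isos])
        (use l u rf in \<open>auto simp: Hom_def\<close>)
    finally show ?thesis .
  qed
  then show ?thesis
    using local_isos_subset_Mor by (auto simp: E_ref_def)
qed

lemma semi_left_exact_pullback:
  assumes "semi_left_exact F" "u \<in> local_isos F" "Cod A u \<in> F" "g \<in> Mor A" "Dom A g \<in> F"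
    "Cod A g = Cod A u"
  obtains g' u' where "pullback_square g' u' u g" "u' \<in> local_isos F" "Cod A u' \<in> F"
  using assms unfolding semi_left_exact_def left_strong_approx_iff by blast

text \<open>The factorization of \<open>f\<close> is obtained by pulling back \<open>\<eta> Y\<close> along the reflection of \<open>f\<close>.\<close>

lemma reflection_factorization:
  assumes F: "F \<subseteq> Ob A" and r: "reflection F r \<eta>" and sle: "semi_left_exact F"
    and f: "f \<in> hom X Y"
  obtains e m u where "pullback_square u m (FMor r f) (\<eta> Y)" "f = m \<cdot> e" "\<eta> X = u \<cdot> e"
    "e \<in> local_isos F" "m \<in> rlp (local_isos F)" "Cod A e = Dom A m" "Cod A e = Dom A u"
proof -
  have XY: "X \<in> Ob A" "Y \<in> Ob A" using Hom_Ob[OF f] by auto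
  note rf = reflection_FMor[OF F r f] and nat = reflection_natural[OF F r f]
  note \<eta> = reflection_unit[OF F r XY(1)] reflection_unit[OF F r XY(2)]
    reflection_unit_local_iso[OF F r XY(1)] reflection_unit_local_iso[OF F r XY(2)]
    reflection_FOb[OF F r XY(1)] reflection_FOb[OF F r XY(2)]
  obtain m u where pb: "pullback_square m u (\<eta> Y) (FMor r f)" and u: "u \<in> local_isos F"
    by (rule semi_left_exact_pullback[OF sle, of "\<eta> Y" "FMor r f"])
      (use \<eta> rf in \<open>auto simp: Hom_def\<close>)
  from pb have pb': "pullback_square u m (FMor r f) (\<eta> Y)" by (simp add: pullback_square_sym)
  then obtain P where h: "u \<in> hom P (FOb r X)" "m \<in> hom P Y"
    and univ: "\<And>W x y. \<lbrakk>x \<in> hom W (FOb r X); y \<in> hom W Y; FMor r f \<cdot> x = \<eta> Y \<cdot> y\<rbrakk>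
      \<Longrightarrow> \<exists>!d. d \<in> hom W P \<and> u \<cdot> d = x \<and> m \<cdot> d = y"
    unfolding pullback_square_def using rf \<eta> by (auto simp: Hom_def)
  obtain e where e: "e \<in> hom X P" "u \<cdot> e = \<eta> X" "m \<cdot> e = f"
    using univ[OF \<eta>(1) f nat] by blast
  have "FMor r f \<in> rlp (local_isos F)"
    using rf \<eta> orthogonal_local_isos[of "{FMor r f}" F] by (auto simp: rlp_def Hom_def)
  then have "m \<in> rlp (local_isos F)"
    by (rule pullback_in_rlp[OF local_isos_subset_Mor pb'])
  \<comment> \<open>Cancellation: \<open>u\<close> and \<open>u \<cdot> e = \<eta> X\<close> are
    both local isomorphisms.\<close>
  moreover have "e \<in> local_isos F"
    using two_out_of_threeD(3)[OF two_out_of_three_local_isos, of e u F] u e h \<eta>(3)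
    by (auto simp: Hom_def)
  ultimately show ?thesis
    using e h by (intro that[OF pb', of e]) (auto simp: Hom_def)
qed

text \<open>\<open>FMor r f\<close> lies between objects of \<open>F\<close>, hence in the
  complement, which is stable under pullback. Conversely, for \<open>f\<close> in the complement the
  comparison \<open>e\<close> from \<open>f\<close> to the pullback is invertible, so the naturality
  square is a pullback too.\<close>

lemma M_ref_eq_rlp:
  assumes F: "F \<subseteq> Ob A" and r: "reflection F r \<eta>" and sle: "semi_left_exact F"
  shows "M_ref r \<eta> = rlp (local_isos F)"
proof (intro set_eqI iffI)
  fix f assume f: "f \<in> M_ref r \<eta>"
  then have f': "f \<in> hom (Dom A f) (Cod A f)" by (auto simp: M_ref_def Hom_def)
  have "FMor r f \<in> rlp (local_isos F)"
    using reflection_FMor[OF F r f'] reflection_FOb[OF F r] Hom_Ob[OF f']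
      orthogonal_local_isos[of "{FMor r f}" F] by (auto simp: rlp_def Hom_def)
  moreover have "pullback_square (\<eta> (Dom A f)) f (FMor r f) (\<eta> (Cod A f))"
    using f by (simp add: M_ref_def)
  ultimately show "f \<in> rlp (local_isos F)"
    using pullback_in_rlp[OF local_isos_subset_Mor] by blast
next
  fix f assume f: "f \<in> rlp (local_isos F)"
  then have [simp]: "f \<in> Mor A" using rlp_subset_Mor by auto
  have f': "f \<in> hom (Dom A f) (Cod A f)" by (simp add: Hom_def)
  obtain e m u where pb: "pullback_square u m (FMor r f) (\<eta> (Cod A f))"
    and me: "f = m \<cdot> e" "\<eta> (Dom A f) = u \<cdot> e" "e \<in> local_isos F" "m \<in> rlp (local_isos F)"
      "Cod A e = Dom A m" "Cod A e = Dom A u"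
    by (rule reflection_factorization[OF F r sle f'])
  have "orthogonal {e} {m}" "orthogonal {e} {m \<cdot> e}"
    using me f orthogonal_rlp[of "local_isos F"] by (auto intro: orthogonal_mono)
  then have "iso e"
    using me local_isos_subset_Mor rlp_subset_Mor
    by (intro iso_of_orthogonal_factorization[of e m]) auto
  then show "f \<in> M_ref r \<eta>"
    using pullback_square_precomp_iso[OF pb _ me(6)] unfolding me(1,2)[symmetric]
    by (simp add: M_ref_def)
qed

lemma class_compI: "\<lbrakk>u \<in> S; p \<in> T; Cod A u = Dom A p\<rbrakk> \<Longrightarrow> p \<cdot> u \<in> class_comp T S"
  unfolding class_comp_def by blast

lemma class_compE:
  assumes "f \<in> class_comp T S"
  obtains p u where "f = p \<cdot> u" "u \<in> S" "p \<in> T" "Cod A u = Dom A p"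
  using assms unfolding class_comp_def by blast

text \<open>Semi-left-exactness supplies the factorizations; the remaining conditions are closure
  properties of local isomorphisms and of \<open>rlp\<close>.\<close>

lemma factorization_system_reflective:
  assumes F: "reflective F" and sle: "semi_left_exact F"
  shows "factorization_system (local_isos F) (rlp (local_isos F))"
proof (rule factorization_systemI)
  obtain r \<eta> where F': "F \<subseteq> Ob A" and r: "reflection F r \<eta>"
    using F by (auto simp: reflective_def full_subcategory_def)
  show "Mor A \<subseteq> class_comp (rlp (local_isos F)) (local_isos F)"
  proof
    fix f assume "f \<in> Mor A"
    then have "f \<in> hom (Dom A f) (Cod A f)" by (simp add: Hom_def)
    then show "f \<in> class_comp (rlp (local_isos F)) (local_isos F)"
      by (rule reflection_factorization[OF F' r sle]) (auto intro: class_compI)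
  qed
next
  fix e m assume "m \<in> Mor A" "iso m" "e \<in> local_isos F" "Cod A e = Dom A m"
  then show "m \<cdot> e \<in> local_isos F"
    using two_out_of_threeD(1)[OF two_out_of_three_local_isos, of e m] iso_in_local_isos
      local_isos_subset_Mor by blast
next
  fix e m assume "e \<in> Mor A" "iso e" "m \<in> rlp (local_isos F)" "Cod A e = Dom A m"
  then show "m \<cdot> e \<in> rlp (local_isos F)"
    by (intro rlp_comp[OF local_isos_subset_Mor iso_in_rlp[OF local_isos_subset_Mor]])
qed (rule local_isos_subset_Mor rlp_subset_Mor orthogonal_rlp)+

lemma local_objects_ex:
  assumes "X \<in> local_objects S" "f \<in> S" "u \<in> hom (Dom A f) X"
  obtains v where "v \<in> hom (Cod A f) X" "v \<cdot> f = u"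
  using assms unfolding local_objects_def by blast

lemma local_objects_unique:
  assumes "X \<in> local_objects S" "f \<in> S" "f \<in> Mor A"
    "v \<in> hom (Cod A f) X" "v' \<in> hom (Cod A f) X" "v \<cdot> f = v' \<cdot> f"
  shows "v = v'"
proof -
  have "v' \<cdot> f \<in> hom (Dom A f) X" using assms by (auto simp: Hom_def)
  then show ?thesis using assms unfolding local_objects_def by blast
qed

text \<open>Recovers \<open>F\<close> from its local isomorphisms. For a local object
  \<open>X\<close> the identity extends along \<open>\<eta> X\<close> to a retraction
  \<open>s\<close>, which is an isomorphism from an object of \<open>F\<close> to \<open>X\<close>,
  and \<open>F\<close> is closed under isomorphisms.\<close>

lemma local_objects_local_isos:
  assumes "reflective F"
  shows "local_objects (local_isos F) = F"
proof
  obtain r \<eta> where F: "F \<subseteq> Ob A" and r: "reflection F r \<eta>" and sub: "full_subcategory F"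
    using assms by (auto simp: reflective_def full_subcategory_def)
  show "F \<subseteq> local_objects (local_isos F)"
    using F unfolding local_objects_def local_isos_def by blast
  show "local_objects (local_isos F) \<subseteq> F"
  proof
    fix X assume X: "X \<in> local_objects (local_isos F)"
    then have XO: "X \<in> Ob A" by (simp add: local_objects_def)
    note \<eta> = reflection_unit[OF F r XO] reflection_unit_local_iso[OF F r XO] reflection_FOb[OF F r XO]
    have "Ident A X \<in> hom (Dom A (\<eta> X)) X" using \<eta>(1) XO by (simp add: Hom_def)
    then obtain s where "s \<in> hom (Cod A (\<eta> X)) X" "s \<cdot> \<eta> X = Ident A X"
      by (rule local_objects_ex[OF X \<eta>(2)])
    then have s: "s \<in> hom (FOb r X) X" "s \<cdot> \<eta> X = Ident A X"
      using \<eta>(1) by (auto simp: Hom_def)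
    have RO: "FOb r X \<in> Ob A" using \<eta> F by auto
    \<comment> \<open>Both sides are endomorphisms of an object of \<open>F\<close> that agree after
      composition with the universal arrow \<open>\<eta> X\<close>.\<close>
    have "\<eta> X \<cdot> s = Ident A (FOb r X)"
      by (rule local_isos_unique[OF \<eta>(2,3)])
        (use s \<eta>(1) XO RO in \<open>auto simp: Hom_def comp_assoc\<close>)
    then have "iso s" using s \<eta>(1) by (intro isoI[of s "FOb r X" X "\<eta> X"]) auto
    then show "X \<in> F" using sub \<eta> s by (auto simp: full_subcategory_def Hom_def)
  qed
qed

text \<open>The argument of \<open>rlp_comp\<close> with the object \<open>Cod A f\<close> in place
  of the second morphism: extend \<open>f \<cdot> u\<close> along \<open>s\<close>, then lift
  against \<open>f\<close>. For trivial cofibrations it says that a fibration over a fibrant object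
  has fibrant domain.\<close>

lemma Dom_rlp_local:
  assumes S: "S \<subseteq> Mor A" and f: "f \<in> rlp S" and X: "Cod A f \<in> local_objects S"
  shows "Dom A f \<in> local_objects S"
proof -
  have [simp]: "f \<in> Mor A" using f rlp_subset_Mor by auto
  have "\<exists>!v. v \<in> hom (Cod A s) (Dom A f) \<and> v \<cdot> s = u"
    if s: "s \<in> S" and u: "u \<in> hom (Dom A s) (Dom A f)" for s u
  proof -
    have [simp]: "s \<in> Mor A" using S s by auto
    have "f \<cdot> u \<in> hom (Dom A s) (Cod A f)" using u by (auto simp: Hom_def)
    then obtain y where y: "y \<in> hom (Cod A s) (Cod A f)" "y \<cdot> s = f \<cdot> u"
      by (rule local_objects_ex[OF X s])
    obtain d where d: "d \<in> hom (Cod A s) (Dom A f)" "d \<cdot> s = u"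
      by (rule orthogonal_ex[OF orthogonal_rlp s f u y(1) y(2)[symmetric]])
    show ?thesis
    proof (rule ex1I[of _ d])
      fix v assume v: "v \<in> hom (Cod A s) (Dom A f) \<and> v \<cdot> s = u"
      have "f \<cdot> v = f \<cdot> d"
        by (rule local_objects_unique[OF X s]) (use v d in \<open>auto simp: Hom_def comp_assoc\<close>)
      show "v = d"
        by (rule orthogonal_unique[OF orthogonal_rlp s f])
          (use v d \<open>f \<cdot> v = f \<cdot> d\<close> in auto)
    qed (use d in auto)
  qed
  then show ?thesis by (simp add: local_objects_def)
qed

lemmas dual_category = category_dual_cat[OF category_axioms]

lemmas dual_simps = iso_dual pushout_square_dual pullback_square_dual orthogonal_dual rlp_dual
  llp_dual class_comp_dual two_out_of_three_dual retract_closed_dual local_isos_dual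
  local_objects_dual left_strong_approx_dual semi_left_exact_dual full_subcategory_dual
  reflection_dual reflective_dual E_ref_dual M_ref_dual

lemma factorization_system_dual:
  "category.factorization_system (dual_cat A) M E \<longleftrightarrow> factorization_system E M"
  by (auto simp: category.factorization_system_def[OF dual_category] factorization_system_def
      dual_simps)

lemma factorization_systemD:
  assumes "factorization_system E M"
  shows "llp M = E" "rlp E = M" "E \<subseteq> Mor A" "M \<subseteq> Mor A" "orthogonal E M"
    "f \<in> Mor A \<Longrightarrow> f \<in> class_comp M E"
proof -
  show "llp M = E" and "rlp E = M" and "f \<in> Mor A \<Longrightarrow> f \<in> class_comp M E"
    using assms by (auto simp: factorization_system_def)
  then show "E \<subseteq> Mor A" "M \<subseteq> Mor A" "orthogonal E M"
    using llp_subset_Mor rlp_subset_Mor orthogonal_rlp by metis+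
qed

lemma iso_in_llp: "\<lbrakk>T \<subseteq> Mor A; iso f\<rbrakk> \<Longrightarrow> f \<in> llp T"
  using category.iso_in_rlp[OF dual_category, of T f] by (simp add: dual_simps)

lemma retract_closed_llp: "T \<subseteq> Mor A \<Longrightarrow> retract_closed (llp T)"
  using category.retract_closed_rlp[OF dual_category, of T] by (simp add: dual_simps)

text \<open>In the category of arrows \<open>m \<cdot> e\<close> is isomorphic to \<open>m\<close>,
  in particular a retract of it.\<close>

lemma retract_closed_comp_iso:
  assumes W: "retract_closed W" "W \<subseteq> Mor A" and m: "m \<in> W" and e: "iso e"
    and me: "Cod A e = Dom A m"
  shows "m \<cdot> e \<in> W"
proof -
  obtain g where g: "e \<in> Mor A" "g \<in> Mor A" "Dom A g = Cod A e" "Cod A g = Dom A e"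
    "g \<cdot> e = Ident A (Dom A e)" "e \<cdot> g = Ident A (Cod A e)"
    using e by (rule isoE)
  have [simp]: "m \<in> Mor A" using W m by auto
  have "retract_of (m \<cdot> e) m"
    unfolding retract_of_def comm_square_def
    by (intro conjI exI[of _ e] exI[of _ "Ident A (Cod A m)"] exI[of _ g])
      (use g me in \<open>auto simp: Hom_def comp_assoc\<close>)
  then show ?thesis using W(1) m unfolding retract_closed_def by blast
qed

lemma retract_closed_iso_comp:
  assumes "retract_closed W" "W \<subseteq> Mor A" "e \<in> W" "iso m" "Cod A e = Dom A m"
  shows "m \<cdot> e \<in> W"
  using category.retract_closed_comp_iso[OF dual_category, of W e m] assms
  by (simp add: dual_simps)

section \<open>Coreflective subcategories\<close>

lemma two_out_of_three_colocal_isos: "two_out_of_three (colocal_isos C)"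
  using category.two_out_of_three_local_isos[OF dual_category, of C] by (simp add: dual_simps)

lemma M_coref_eq_colocal_isos:
  "\<lbrakk>C \<subseteq> Ob A; coreflection C t \<epsilon>\<rbrakk> \<Longrightarrow> M_coref t = colocal_isos C"
  using category.E_ref_eq_local_isos[OF dual_category, of C t \<epsilon>] by (simp add: dual_simps)

lemma E_coref_eq_llp:
  "\<lbrakk>C \<subseteq> Ob A; coreflection C t \<epsilon>; semi_right_exact C\<rbrakk> \<Longrightarrow> E_coref t \<epsilon> = llp (colocal_isos C)"
  using category.M_ref_eq_rlp[OF dual_category, of C t \<epsilon>] by (simp add: dual_simps)

lemma factorization_system_coreflective:
  "\<lbrakk>coreflective C; semi_right_exact C\<rbrakk>
    \<Longrightarrow> factorization_system (llp (colocal_isos C)) (colocal_isos C)"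
  using category.factorization_system_reflective[OF dual_category, of C]
  by (simp add: dual_simps factorization_system_dual)

lemma colocal_objects_colocal_isos: "coreflective C \<Longrightarrow> colocal_objects (colocal_isos C) = C"
  using category.local_objects_local_isos[OF dual_category, of C] by (simp add: dual_simps)

section \<open>Reflectivity from a factorization system\<close>

lemma subset_local_isos: "E \<subseteq> Mor A \<Longrightarrow> E \<subseteq> local_isos (local_objects E)"
  unfolding local_objects_def local_isos_def by blast

text \<open>A local isomorphism \<open>f\<close> is compared with a map \<open>g\<close> between
  local objects through approximations \<open>i\<close>, \<open>j\<close> in \<open>E\<close> with
  \<open>g \<cdot> i = j \<cdot> f\<close>. Then \<open>g\<close> is a local isomorphism between
  local objects, so invertible, so in \<open>E\<close>, and two-out-of-three returns this to
  \<open>f\<close>.\<close>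

lemma local_isos_local_objects:
  assumes fs: "factorization_system E M" and E: "two_out_of_three E"
    and enough: "\<And>X. X \<in> Ob A \<Longrightarrow> \<exists>F \<in> local_objects E. \<exists>i \<in> E. i \<in> hom X F"
  shows "local_isos (local_objects E) = E"
proof
  note fsD = factorization_systemD[OF fs]
  let ?F = "local_objects E"
  show EL: "E \<subseteq> local_isos ?F"
    by (rule subset_local_isos[OF fsD(3)])
  show "local_isos ?F \<subseteq> E"
  proof
    fix f assume f: "f \<in> local_isos ?F"
    then have [simp]: "f \<in> Mor A" using local_isos_subset_Mor by blast
    obtain G i where i: "G \<in> ?F" "i \<in> E" "i \<in> hom (Dom A f) G"
      using enough[of "Dom A f"] by auto
    obtain H j where j: "H \<in> ?F" "j \<in> E" "j \<in> hom (Cod A f) H"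
      using enough[of "Cod A f"] by auto
    have [simp]: "i \<in> Mor A" "j \<in> Mor A" using i j by (auto simp: Hom_def)
    have iL: "i \<in> local_isos ?F" and jL: "j \<in> local_isos ?F" using i j EL by auto
    have jf: "j \<cdot> f \<in> local_isos ?F"
      by (rule two_out_of_threeD(1)[OF two_out_of_three_local_isos])
        (use f jL j in \<open>auto simp: Hom_def\<close>)
    obtain g where g: "g \<in> hom (Cod A i) H" "g \<cdot> i = j \<cdot> f"
      by (rule local_isos_ex[OF iL j(1), of "j \<cdot> f"]) (use i j in \<open>auto simp: Hom_def\<close>)
    have "g \<in> local_isos ?F"
      by (rule two_out_of_threeD(2)[OF two_out_of_three_local_isos, of i])
        (use iL jf g in \<open>auto simp: Hom_def\<close>)
    then have "iso g"
      by (rule iso_of_local_iso) (use i j g in \<open>auto simp: Hom_def\<close>)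
    then have "g \<in> E" using iso_in_llp[OF fsD(4)] fsD(1) by auto
    then have "g \<cdot> i \<in> E"
      by (intro two_out_of_threeD(1)[OF E]) (use i g in \<open>auto simp: Hom_def\<close>)
    then show "f \<in> E"
      by (intro two_out_of_threeD(3)[OF E, of f j]) (use g j in \<open>auto simp: Hom_def\<close>)
  qed
qed

text \<open>The morphisms given by \<open>enough\<close> are universal arrows because
  \<open>E\<close> consists of local isomorphisms. Closure under isomorphisms is
  \<open>Dom_rlp_local\<close> applied to an inverse.\<close>

lemma reflective_local_objects:
  assumes fs: "factorization_system E M"
    and enough: "\<And>X. X \<in> Ob A \<Longrightarrow> \<exists>F \<in> local_objects E. \<exists>i \<in> E. i \<in> hom X F"
  shows "reflective (local_objects E)"
proof -
  note fsD = factorization_systemD[OF fs]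
  let ?F = "local_objects E"
  have sub: "?F \<subseteq> Ob A" by (auto simp: local_objects_def)
  have "Cod A f \<in> ?F" if f: "iso f" "Dom A f \<in> ?F" for f
  proof -
    obtain g where "iso g" "Dom A g = Cod A f" "Cod A g = Dom A f" using f(1) by (rule inverse_iso)
    then show ?thesis
      using f Dom_rlp_local[OF fsD(3) iso_in_rlp[OF fsD(3)], of g] by simp
  qed
  then have "full_subcategory ?F" using sub by (auto simp: full_subcategory_def)
  moreover have "\<exists>r \<eta>. reflection ?F r \<eta>"
  proof (rule reflection_ex[OF sub])
    fix X assume "X \<in> Ob A"
    then obtain F i where i: "F \<in> ?F" "i \<in> E" "i \<in> hom X F" using enough by blast
    then have "i \<in> local_isos ?F"
      using subset_local_isos[OF fsD(3)] by blast
    then show "\<exists>u. left_strong_approx ?F u \<and> Dom A u = X"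
      using i by (intro exI[of _ i]) (auto simp: left_strong_approx_iff Hom_def)
  qed
  ultimately show ?thesis by (simp add: reflective_def)
qed

text \<open>A morphism between local objects lies in \<open>M\<close>, so the pullback condition for
  \<open>M\<close> covers all those that semi-left-exactness asks for.\<close>

lemma semi_left_exact_local_objects:
  assumes fs: "factorization_system E M" and E: "two_out_of_three E"
    and enough: "\<And>X. X \<in> Ob A \<Longrightarrow> \<exists>F \<in> local_objects E. \<exists>i \<in> E. i \<in> hom X F"
    and pb: "\<And>i v. \<lbrakk>i \<in> E; v \<in> M; Cod A i \<in> local_objects E; Cod A v = Cod A i\<rbrakk>
      \<Longrightarrow> \<exists>w j. pullback_square w j i v \<and> j \<in> E"
  shows "semi_left_exact (local_objects E)"
proof -
  let ?F = "local_objects E"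
  have eq: "local_isos ?F = E" by (rule local_isos_local_objects[OF fs E enough])
  show ?thesis
    unfolding semi_left_exact_def left_strong_approx_iff eq
  proof (intro allI impI)
    fix u g
    assume u: "u \<in> E \<and> Cod A u \<in> ?F" and g: "g \<in> Mor A" "Dom A g \<in> ?F" "Cod A g = Cod A u"
    have "orthogonal (local_isos ?F) {g}"
      by (rule orthogonal_local_isos) (use g u in auto)
    then have "g \<in> M" using factorization_systemD(2)[OF fs] g by (auto simp: rlp_def eq)
    then obtain w j where wj: "pullback_square w j u g" "j \<in> E" using pb[of u g] u g by auto
    moreover have "Cod A j = Dom A g"
      using wj(1) unfolding pullback_square_def Hom_def by auto
    ultimately show "\<exists>g' u'. pullback_square g' u' u g \<and> u' \<in> E \<and> Cod A u' \<in> ?F"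
      using g by metis
  qed
qed

lemma colocal_isos_colocal_objects:
  assumes "factorization_system E M" "two_out_of_three M"
    and "\<And>X. X \<in> Ob A \<Longrightarrow> \<exists>C \<in> colocal_objects M. \<exists>p \<in> M. p \<in> hom C X"
  shows "colocal_isos (colocal_objects M) = M"
  using category.local_isos_local_objects[OF dual_category, of M E] assms
  by (simp add: dual_simps factorization_system_dual)

lemma coreflective_colocal_objects:
  assumes "factorization_system E M"
    and "\<And>X. X \<in> Ob A \<Longrightarrow> \<exists>C \<in> colocal_objects M. \<exists>p \<in> M. p \<in> hom C X"
  shows "coreflective (colocal_objects M)"
  using category.reflective_local_objects[OF dual_category, of M E] assms
  by (simp add: dual_simps factorization_system_dual)

lemma semi_right_exact_colocal_objects:
  assumes "factorization_system E M" "two_out_of_three M"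
    and "\<And>X. X \<in> Ob A \<Longrightarrow> \<exists>C \<in> colocal_objects M. \<exists>p \<in> M. p \<in> hom C X"
    and "\<And>p u. \<lbrakk>p \<in> M; u \<in> E; Dom A p \<in> colocal_objects M; Dom A u = Dom A p\<rbrakk>
      \<Longrightarrow> \<exists>w q. pushout_square p u w q \<and> q \<in> M"
  shows "semi_right_exact (colocal_objects M)"
  using category.semi_left_exact_local_objects[OF dual_category, of M E] assms
  by (simp add: dual_simps factorization_system_dual)

section \<open>Two compatible factorization systems\<close>

text \<open>\<open>E1\<close>, \<open>M1\<close>, \<open>E2\<close>, \<open>M2\<close> stand for
  trivial cofibrations, fibrations, cofibrations and trivial fibrations. The notion is self-dual
  under exchanging \<open>E1\<close> with \<open>M2\<close> and \<open>M1\<close> with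
  \<open>E2\<close>, which halves the work below.\<close>

definition compatible :: "'m set \<Rightarrow> 'm set \<Rightarrow> 'm set \<Rightarrow> 'm set \<Rightarrow> bool" where
  "compatible E1 M1 E2 M2 \<longleftrightarrow> factorization_system E1 M1 \<and> factorization_system E2 M2 \<and>
    orthogonal E1 M2 \<and> two_out_of_three E1 \<and> two_out_of_three M2 \<and>
    class_comp E1 M2 \<subseteq> class_comp M2 E1"

lemma compatible_dual:
  "category.compatible (dual_cat A) M2 E2 M1 E1 \<longleftrightarrow> compatible E1 M1 E2 M2"
  by (auto simp: category.compatible_def[OF dual_category] compatible_def dual_simps
      factorization_system_dual)

text \<open>Lifting each factorization against the other gives \<open>d\<close> and
  \<open>d'\<close>; their composites solve the same lifting problems as identities.\<close>

lemma factorization_unique: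
  assumes fs: "factorization_system E M" and "e \<in> E" "m \<in> M" "e' \<in> E" "m' \<in> M"
    and em: "Cod A e = Dom A m" "Cod A e' = Dom A m'" and eq: "m \<cdot> e = m' \<cdot> e'"
  obtains d where "iso d" "Cod A d = Dom A m'" "m = m' \<cdot> d"
proof -
  note fsD = factorization_systemD[OF fs]
  have [simp]: "e \<in> Mor A" "m \<in> Mor A" "e' \<in> Mor A" "m' \<in> Mor A" using assms fsD(3,4) by auto
  have D: "Dom A e = Dom A e'" "Cod A m = Cod A m'"
    using arg_cong[OF eq, of "Dom A"] arg_cong[OF eq, of "Cod A"] em by auto
  obtain d where d: "d \<in> hom (Cod A e) (Dom A m')" "d \<cdot> e = e'" "m' \<cdot> d = m"
    by (rule orthogonal_ex[OF fsD(5) assms(2,5), of e' m]) (use em eq D in \<open>auto simp: Hom_def\<close>)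
  obtain d' where d': "d' \<in> hom (Cod A e') (Dom A m)" "d' \<cdot> e' = e" "m \<cdot> d' = m'"
    by (rule orthogonal_ex[OF fsD(5) assms(4,3), of e m']) (use em eq D in \<open>auto simp: Hom_def\<close>)
  have [simp]: "d \<in> Mor A" "d' \<in> Mor A" using d d' by (auto simp: Hom_def)
  have "d' \<cdot> d = Ident A (Cod A e)"
    by (rule orthogonal_unique[OF fsD(5) assms(2,3)])
      (use d d' em comp_assoc[of e d d'] comp_assoc[of d d' m] in \<open>auto simp: Hom_def\<close>)
  moreover have "d \<cdot> d' = Ident A (Cod A e')"
    by (rule orthogonal_unique[OF fsD(5) assms(4,5)])
      (use d d' em comp_assoc[of e' d' d] comp_assoc[of d' d m'] in \<open>auto simp: Hom_def\<close>)
  ultimately have "iso d"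
    using d d' em by (intro isoI[of d "Cod A e" "Cod A e'" d']) (auto simp: Hom_def)
  then show ?thesis using d by (intro that[of d]) (auto simp: Hom_def)
qed

lemma compatible_subset:
  assumes "compatible E1 M1 E2 M2"
  shows "E1 \<subseteq> E2" "M2 \<subseteq> M1"
proof -
  have fs: "factorization_system E1 M1" "factorization_system E2 M2" "orthogonal E1 M2"
    using assms by (auto simp: compatible_def)
  note fsD = factorization_systemD[OF fs(1)] factorization_systemD[OF fs(2)]
  show "E1 \<subseteq> E2" using subset_llp[OF fs(3) fsD(3)] fsD(7) by simp
  show "M2 \<subseteq> M1" using subset_rlp[OF fs(3) fsD(10)] fsD(2) by simp
qed

text \<open>Weak equivalence can thus be tested on any \<open>(E1, M1)\<close>-factorization,
  whichever factorization witnesses it.\<close>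

lemma compatible_weak_equivalence:
  assumes co: "compatible E1 M1 E2 M2" and i: "i \<in> E1" and p: "p \<in> M1" and ip: "Cod A i = Dom A p"
    and W: "p \<cdot> i \<in> class_comp M2 E1"
  shows "p \<in> M2"
proof -
  have fs: "factorization_system E1 M1" "factorization_system E2 M2"
    using co by (auto simp: compatible_def)
  note fsD = factorization_systemD[OF fs(2)]
  obtain m e where me: "p \<cdot> i = m \<cdot> e" "e \<in> E1" "m \<in> M2" "Cod A e = Dom A m"
    using W by (rule class_compE)
  obtain d where d: "iso d" "Cod A d = Dom A m" "p = m \<cdot> d"
    by (rule factorization_unique[OF fs(1) i p me(2) _ ip me(4) me(1)])
      (use me compatible_subset[OF co] in auto)
  have "m \<cdot> d \<in> rlp E2"
    using me(3) d(2) fsD(2) by (intro rlp_comp[OF fsD(3) iso_in_rlp[OF fsD(3) d(1)]]) auto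
  then show ?thesis using d(3) fsD(2) by simp
qed

lemma Ident_in_factorization_system:
  assumes "factorization_system E M" "X \<in> Ob A"
  shows "Ident A X \<in> E" "Ident A X \<in> M"
  using factorization_systemD[OF assms(1)] iso_Ident[OF assms(2)] iso_in_llp iso_in_rlp by metis+

text \<open>A morphism of \<open>M1\<close> is factored with an identity as its
  \<open>E1\<close>-part, so the preceding test applies to it directly.\<close>

lemma trivial_fibrations:
  assumes co: "compatible E1 M1 E2 M2"
  shows "M1 \<inter> class_comp M2 E1 = M2"
proof (intro equalityI subsetI)
  have fs: "factorization_system E1 M1" "factorization_system E2 M2"
    using co by (auto simp: compatible_def)
  note fsD = factorization_systemD[OF fs(1)] factorization_systemD[OF fs(2)]
  {
    fix f assume f: "f \<in> M1 \<inter> class_comp M2 E1"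
    then have [simp]: "f \<in> Mor A" using fsD(4) by auto
    show "f \<in> M2"
      by (rule compatible_weak_equivalence[OF co, of "Ident A (Dom A f)"])
        (use f Ident_in_factorization_system[OF fs(1)] in auto)
  next
    fix f assume f: "f \<in> M2"
    then have [simp]: "f \<in> Mor A" using fsD(10) by auto
    have "f \<cdot> Ident A (Dom A f) \<in> class_comp M2 E1"
      using f Ident_in_factorization_system[OF fs(1)] by (intro class_compI) auto
    then show "f \<in> M1 \<inter> class_comp M2 E1" using f compatible_subset[OF co] by auto
  }
qed

lemma trivial_cofibrations:
  assumes "compatible E1 M1 E2 M2"
  shows "E2 \<inter> class_comp M2 E1 = E1"
  using category.trivial_fibrations[OF dual_category, of M2 E2 M1 E1] assms
  by (simp add: dual_simps compatible_dual)

lemma weak_equivalences_subset_Mor: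
  assumes "compatible E1 M1 E2 M2"
  shows "class_comp M2 E1 \<subseteq> Mor A"
proof -
  have fs: "factorization_system E1 M1" "factorization_system E2 M2"
    using assms by (auto simp: compatible_def)
  show ?thesis
    using factorization_systemD(3)[OF fs(1)] factorization_systemD(4)[OF fs(2)]
    by (blast elim: class_compE intro: comp_Mor)
qed

text \<open>Regroups four factors \<open>q\<close>, \<open>j\<close>, \<open>p\<close>,
  \<open>i\<close> after the middle pair \<open>j \<cdot> p\<close> has been rewritten as
  \<open>n \<cdot> k\<close>.\<close>

lemma class_comp_assoc:
  assumes f: "f = p \<cdot> i" and g: "g = q \<cdot> j"
    and m [simp]: "i \<in> Mor A" "p \<in> Mor A" "j \<in> Mor A" "q \<in> Mor A"
    and c: "Cod A i = Dom A p" "Cod A j = Dom A q" "Cod A p = Dom A j"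
    and n: "n \<in> Mor A" "k \<in> Mor A" "Cod A k = Dom A n" "j \<cdot> p = n \<cdot> k"
  shows "g \<cdot> f = (q \<cdot> n) \<cdot> (k \<cdot> i)" "Dom A k = Dom A p" "Cod A n = Cod A j"
proof -
  show D: "Dom A k = Dom A p" "Cod A n = Cod A j"
    using arg_cong[OF n(4), of "Dom A"] arg_cong[OF n(4), of "Cod A"] n(1-3) c by auto
  have "g \<cdot> f = q \<cdot> ((j \<cdot> p) \<cdot> i)" using f g c by (simp add: comp_assoc)
  also have "\<dots> = (q \<cdot> n) \<cdot> (k \<cdot> i)" unfolding n(4) using n c D by (simp add: comp_assoc)
  finally show "g \<cdot> f = (q \<cdot> n) \<cdot> (k \<cdot> i)" .
qed

text \<open>The exchange condition of \<open>compatible\<close> swaps the two middle factors, after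
  which \<open>M2\<close> and \<open>E1\<close> are each closed under composition.\<close>

lemma weak_equivalence_comp:
  assumes co: "compatible E1 M1 E2 M2" and f: "f \<in> class_comp M2 E1" and g: "g \<in> class_comp M2 E1"
    and fg: "Cod A f = Dom A g"
  shows "g \<cdot> f \<in> class_comp M2 E1"
proof -
  have fs: "factorization_system E1 M1" "factorization_system E2 M2"
    and t: "two_out_of_three E1" "two_out_of_three M2"
    and c: "class_comp E1 M2 \<subseteq> class_comp M2 E1"
    using co by (auto simp: compatible_def)
  have S: "E1 \<subseteq> Mor A" "M2 \<subseteq> Mor A"
    using factorization_systemD(3)[OF fs(1)] factorization_systemD(4)[OF fs(2)] .
  obtain p i where f: "f = p \<cdot> i" "i \<in> E1" "p \<in> M2" "Cod A i = Dom A p"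
    using f by (rule class_compE)
  obtain q j where g: "g = q \<cdot> j" "j \<in> E1" "q \<in> M2" "Cod A j = Dom A q"
    using g by (rule class_compE)
  have [simp]: "i \<in> Mor A" "p \<in> Mor A" "j \<in> Mor A" "q \<in> Mor A" using f g S by auto
  have pj: "Cod A p = Dom A j" using fg f g by auto
  have "j \<cdot> p \<in> class_comp M2 E1" using c class_compI[OF f(3) g(2) pj] by auto
  then obtain n k where n: "j \<cdot> p = n \<cdot> k" "k \<in> E1" "n \<in> M2" "Cod A k = Dom A n"
    by (rule class_compE)
  have nk: "n \<in> Mor A" "k \<in> Mor A" using n S by auto
  note * = class_comp_assoc[OF f(1) g(1) _ _ _ _ f(4) g(4) pj nk n(4) n(1), simplified]
  have "q \<cdot> n \<in> M2" "k \<cdot> i \<in> E1"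
    using two_out_of_threeD(1)[OF t(2), of n q] two_out_of_threeD(1)[OF t(1), of i k] n nk f g *
    by auto
  then show ?thesis unfolding *(1) using n nk f g * by (intro class_compI) auto
qed

text \<open>With \<open>g = q \<cdot> j\<close> factored by \<open>(E1, M1)\<close>, the same
  exchange yields a factorization of \<open>g \<cdot> f\<close> with \<open>M1\<close>-part
  \<open>q \<cdot> n\<close>. That part lies in \<open>M2\<close> by
  \<open>compatible_weak_equivalence\<close>, and cancelling \<open>n\<close> puts \<open>q\<close>
  in \<open>M2\<close>.\<close>

lemma weak_equivalence_cancel_right:
  assumes co: "compatible E1 M1 E2 M2" and f: "f \<in> class_comp M2 E1"
    and gf: "g \<cdot> f \<in> class_comp M2 E1" and [simp]: "g \<in> Mor A" and fg: "Cod A f = Dom A g"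
  shows "g \<in> class_comp M2 E1"
proof -
  have fs: "factorization_system E1 M1" "factorization_system E2 M2"
    and t: "two_out_of_three E1" "two_out_of_three M2"
    and c: "class_comp E1 M2 \<subseteq> class_comp M2 E1"
    using co by (auto simp: compatible_def)
  note fsD = factorization_systemD[OF fs(1)]
  have S: "E1 \<subseteq> Mor A" "M2 \<subseteq> Mor A" "M1 \<subseteq> Mor A"
    using fsD factorization_systemD(4)[OF fs(2)] by auto
  obtain p i where f: "f = p \<cdot> i" "i \<in> E1" "p \<in> M2" "Cod A i = Dom A p"
    using f by (rule class_compE)
  obtain q j where g: "g = q \<cdot> j" "j \<in> E1" "q \<in> M1" "Cod A j = Dom A q"
    using fsD(6)[OF \<open>g \<in> Mor A\<close>] by (rule class_compE)
  have [simp]: "i \<in> Mor A" "p \<in> Mor A" "j \<in> Mor A" "q \<in> Mor A" using f g S by auto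
  have pj: "Cod A p = Dom A j" using fg f g by auto
  have "j \<cdot> p \<in> class_comp M2 E1" using c class_compI[OF f(3) g(2) pj] by auto
  then obtain n k where n: "j \<cdot> p = n \<cdot> k" "k \<in> E1" "n \<in> M2" "Cod A k = Dom A n"
    by (rule class_compE)
  have nk: "n \<in> Mor A" "k \<in> Mor A" using n S by auto
  note * = class_comp_assoc[OF f(1) g(1) _ _ _ _ f(4) g(4) pj nk n(4) n(1), simplified]
  have qn: "q \<cdot> n \<in> M1"
    using rlp_comp[OF fsD(3), of n q] n g nk * compatible_subset[OF co] fsD(2) by auto
  have ki: "k \<cdot> i \<in> E1"
    using two_out_of_threeD(1)[OF t(1), of i k] n nk f * by auto
  have "q \<cdot> n \<in> M2"
    by (rule compatible_weak_equivalence[OF co ki qn]) (use gf * n nk f g in auto)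
  then have "q \<in> M2"
    using two_out_of_threeD(2)[OF t(2), of n q] n nk g * by auto
  then show ?thesis using g class_compI by metis
qed

lemma weak_equivalence_cancel_left:
  assumes "compatible E1 M1 E2 M2" "g \<in> class_comp M2 E1" "g \<cdot> f \<in> class_comp M2 E1" "f \<in> Mor A"
    "Cod A f = Dom A g"
  shows "f \<in> class_comp M2 E1"
  using category.weak_equivalence_cancel_right[OF dual_category, of M2 E2 M1 E1 g f] assms
  by (simp add: dual_simps compatible_dual)

lemma two_out_of_three_weak_equivalences:
  assumes "compatible E1 M1 E2 M2"
  shows "two_out_of_three (class_comp M2 E1)"
  using weak_equivalence_comp[OF assms] weak_equivalence_cancel_right[OF assms]
    weak_equivalence_cancel_left[OF assms]
  unfolding two_out_of_three_def by blast

text \<open>A retract of morphisms induces a retract of the \<open>M1\<close>-parts of their factorizations.\<close>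

lemma retract_closed_weak_equivalences:
  assumes co: "compatible E1 M1 E2 M2"
  shows "retract_closed (class_comp M2 E1)"
  unfolding retract_closed_def
proof (intro allI impI)
  have fs: "factorization_system E1 M1" "factorization_system E2 M2"
    using co by (auto simp: compatible_def)
  note fsD = factorization_systemD[OF fs(1)] and fsD2 = factorization_systemD[OF fs(2)]
  fix f w assume w: "w \<in> class_comp M2 E1" and "retract_of f w"
  then obtain s s' p p' where [simp]: "f \<in> Mor A" "w \<in> Mor A"
    and s: "s \<in> hom (Dom A f) (Dom A w)" "s' \<in> hom (Cod A f) (Cod A w)" "w \<cdot> s = s' \<cdot> f"
    and p: "p \<in> hom (Dom A w) (Dom A f)" "p' \<in> hom (Cod A w) (Cod A f)" "f \<cdot> p = p' \<cdot> w"
    and ps: "p \<cdot> s = Ident A (Dom A f)" "p' \<cdot> s' = Ident A (Cod A f)"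
    by (auto simp: retract_of_def comm_square_def)
  obtain m e where w: "w = m \<cdot> e" "e \<in> E1" "m \<in> M2" "Cod A e = Dom A m"
    using w by (rule class_compE)
  obtain q i where f: "f = q \<cdot> i" "i \<in> E1" "q \<in> M1" "Cod A i = Dom A q"
    using fsD(6)[OF \<open>f \<in> Mor A\<close>] by (rule class_compE)
  have m1: "m \<in> M1" using w compatible_subset[OF co] by auto
  have [simp]: "i \<in> Mor A" "q \<in> Mor A" "e \<in> Mor A" "m \<in> Mor A" using f w fsD fsD2 by auto
  have [simp]: "s \<in> Mor A" "s' \<in> Mor A" "p \<in> Mor A" "p' \<in> Mor A" using s p by (auto simp: Hom_def)
  have D: "Dom A s = Dom A i" "Cod A s = Dom A e" "Dom A s' = Cod A q" "Cod A s' = Cod A m"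
    "Dom A p = Dom A e" "Cod A p = Dom A i" "Dom A p' = Cod A m" "Cod A p' = Cod A q"
    using s p f w by (auto simp: Hom_def)
  have mes: "m \<cdot> (e \<cdot> s) = (s' \<cdot> q) \<cdot> i" and qip: "q \<cdot> (i \<cdot> p) = (p' \<cdot> m) \<cdot> e"
    using s(3) p(3) f w D by (auto simp: comp_assoc)
  have ps': "p \<cdot> s = Ident A (Dom A i)" "p' \<cdot> s' = Ident A (Cod A q)" using ps f by auto
  \<comment> \<open>\<open>d\<close> and \<open>d'\<close> are the maps that the retract diagram
    induces between the middle objects of the two factorizations.\<close>
  obtain d where d: "d \<in> hom (Cod A i) (Dom A m)" "d \<cdot> i = e \<cdot> s" "m \<cdot> d = s' \<cdot> q"
    by (rule orthogonal_ex[OF fsD(5) f(2) m1 _ _ mes]) (use D w f in \<open>auto simp: Hom_def\<close>)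
  obtain d' where d': "d' \<in> hom (Cod A e) (Dom A q)" "d' \<cdot> e = i \<cdot> p" "q \<cdot> d' = p' \<cdot> m"
    by (rule orthogonal_ex[OF fsD(5) w(2) f(3) _ _ qip]) (use D w f in \<open>auto simp: Hom_def\<close>)
  have [simp]: "d \<in> Mor A" "d' \<in> Mor A" and Dd: "Dom A d = Cod A i" "Cod A d = Dom A m"
    "Dom A d' = Cod A e" "Cod A d' = Dom A q"
    using d d' by (auto simp: Hom_def)
  have di: "(d' \<cdot> d) \<cdot> i = i"
  proof -
    have "(d' \<cdot> d) \<cdot> i = (d' \<cdot> e) \<cdot> s" using d(2) Dd D w by (simp add: comp_assoc)
    also have "\<dots> = i \<cdot> (p \<cdot> s)" unfolding d'(2) using D by (simp add: comp_assoc)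
    finally show ?thesis using ps' by simp
  qed
  have qd: "q \<cdot> (d' \<cdot> d) = q"
  proof -
    have "q \<cdot> (d' \<cdot> d) = (q \<cdot> d') \<cdot> d" using Dd w by (simp add: comp_assoc)
    also have "\<dots> = p' \<cdot> (m \<cdot> d)" unfolding d'(3) using D Dd by (simp add: comp_assoc)
    also have "\<dots> = (p' \<cdot> s') \<cdot> q" unfolding d(3) using D by (simp add: comp_assoc)
    finally show ?thesis using ps' by simp
  qed
  \<comment> \<open>\<open>d' \<cdot> d\<close> and the identity are both diagonals of the square
    from \<open>i\<close> to \<open>q\<close>.\<close>
  have dd: "d' \<cdot> d = Ident A (Dom A q)"
    by (rule orthogonal_unique[OF fsD(5) f(2,3)]) (use di qd Dd w(4) f(4) in \<open>auto simp: Hom_def\<close>)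
  have "retract_of q m"
    unfolding retract_of_def comm_square_def
    by (intro conjI exI[of _ d] exI[of _ s'] exI[of _ d'] exI[of _ p'])
      (use d d' dd D Dd ps' w f in \<open>auto simp: Hom_def\<close>)
  then have "q \<in> M2"
    using retract_closed_rlp[OF fsD2(3)] fsD2(2) w(3) unfolding retract_closed_def by metis
  then show "f \<in> class_comp M2 E1" using f class_compI by metis
qed

section \<open>Bi-reflective pairs and model structures\<close>

lemma fibrant_objects_eq: "fibrant_objects (CoFib, Fib, Weq) = local_objects (CoFib \<inter> Weq)"
  and cofibrant_objects_eq: "cofibrant_objects (CoFib, Fib, Weq) = colocal_objects (Fib \<inter> Weq)"
  by (simp_all add: fibrant_objects_def local_objects_def cofibrant_objects_def colocal_objects_def)

lemma reflective_enough:
  assumes "reflective F" "X \<in> Ob A"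
  shows "\<exists>G \<in> F. \<exists>i \<in> local_isos F. i \<in> hom X G"
proof -
  obtain r \<eta> where F: "F \<subseteq> Ob A" and r: "reflection F r \<eta>"
    using assms by (auto simp: reflective_def full_subcategory_def)
  show ?thesis
    using reflection_FOb[OF F r assms(2)] reflection_unit[OF F r assms(2)]
      reflection_unit_local_iso[OF F r assms(2)] by blast
qed

lemma coreflective_enough:
  "\<lbrakk>coreflective C; X \<in> Ob A\<rbrakk> \<Longrightarrow> \<exists>G \<in> C. \<exists>p \<in> colocal_isos C. p \<in> hom G X"
  using category.reflective_enough[OF dual_category, of C X] by (simp add: dual_simps)

lemma E_ref_reflector: "reflective F \<Longrightarrow> E_ref (fst (reflector F)) = local_isos F"
  using reflector_reflection[of F] E_ref_eq_local_isos[of F]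
  by (auto simp: reflective_def full_subcategory_def split: prod.splits)

lemma M_coref_coreflector: "coreflective C \<Longrightarrow> M_coref (fst (coreflector C)) = colocal_isos C"
  using coreflector_coreflection[of C] M_coref_eq_colocal_isos[of C]
  by (auto simp: coreflective_def full_subcategory_def split: prod.splits)

text \<open>Eliminates the chosen adjoints, since the classes in both compatibility conditions
  depend on \<open>C\<close> and \<open>F\<close> alone.\<close>

lemma mem_bireflective_pairs_iff:
  "(C, F) \<in> bireflective_pairs \<longleftrightarrow>
    coreflective C \<and> semi_right_exact C \<and> reflective F \<and> semi_left_exact F \<and>
    orthogonal (local_isos F) (colocal_isos C) \<and>
    class_comp (local_isos F) (colocal_isos C) \<subseteq> class_comp (colocal_isos C) (local_isos F)"
  unfolding bireflective_pairs_def Let_def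
  using E_ref_reflector[of F] M_coref_coreflector[of C] by auto

text \<open>The right-hand side does not mention \<open>t\<close>, \<open>\<epsilon>\<close>,
  \<open>r\<close> or \<open>\<eta>\<close>, so every choice of adjoints gives the same
  triple.\<close>

lemma induced_model_eq:
  assumes "(C, F) \<in> bireflective_pairs" "coreflection C t \<epsilon>" "reflection F r \<eta>"
  shows "induced_model t \<epsilon> r \<eta> = (llp (colocal_isos C), rlp (local_isos F),
    class_comp (colocal_isos C) (local_isos F))"
proof -
  have "C \<subseteq> Ob A" "F \<subseteq> Ob A" "semi_right_exact C" "semi_left_exact F"
    using assms(1)
    by (auto simp: mem_bireflective_pairs_iff coreflective_def reflective_def full_subcategory_def)
  then show ?thesis
    using assms
    by (simp add: induced_model_def E_ref_eq_local_isos M_ref_eq_rlp M_coref_eq_colocal_isos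
        E_coref_eq_llp)
qed

lemma Phi_eq:
  assumes "(C, F) \<in> bireflective_pairs"
  shows "Phi (C, F) = (llp (colocal_isos C), rlp (local_isos F),
    class_comp (colocal_isos C) (local_isos F))"
proof -
  have "coreflective C" "reflective F" using assms by (auto simp: mem_bireflective_pairs_iff)
  then show ?thesis
    using coreflector_coreflection[of C] reflector_reflection[of F] induced_model_eq[OF assms]
    by (auto simp: Phi_def split: prod.splits)
qed

section \<open>From pairs to model structures\<close>

lemma compatible_bireflective_pair:
  assumes "(C, F) \<in> bireflective_pairs"
  shows "compatible (local_isos F) (rlp (local_isos F)) (llp (colocal_isos C)) (colocal_isos C)"
  using assms factorization_system_reflective[of F] factorization_system_coreflective[of C]
    two_out_of_three_local_isos two_out_of_three_colocal_isos
  by (simp add: mem_bireflective_pairs_iff compatible_def)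

lemma orthogonal_has_liftings: "orthogonal S T \<Longrightarrow> has_liftings S T"
  unfolding orthogonal_def has_liftings_def by blast

text \<open>The trivial cofibrations and trivial fibrations of \<open>Phi (C, F)\<close> are the
  local and colocal isomorphisms, whose local and colocal objects are \<open>F\<close> and
  \<open>C\<close>.\<close>

lemma Psi_Phi:
  assumes p: "(C, F) \<in> bireflective_pairs"
  shows "Psi (Phi (C, F)) = (C, F)"
proof -
  note co = compatible_bireflective_pair[OF p]
  have "coreflective C" "reflective F" using p by (auto simp: mem_bireflective_pairs_iff)
  then show ?thesis
    by (simp add: Phi_eq[OF p] Psi_def fibrant_objects_eq cofibrant_objects_eq
        trivial_fibrations[OF co] trivial_cofibrations[OF co] local_objects_local_isos
        colocal_objects_colocal_isos)
qed

text \<open>Semi-left-exactness concerns morphisms between objects of \<open>F\<close>. A fibration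
  with codomain in \<open>F\<close> is one of these, by \<open>Dom_rlp_local\<close>.\<close>

lemma pullback_along_fibration:
  assumes F: "reflective F" "semi_left_exact F" and i: "i \<in> local_isos F" "Cod A i \<in> F"
    and v: "v \<in> rlp (local_isos F)" "Cod A v = Cod A i"
  shows "\<exists>w j. pullback_square w j i v \<and> j \<in> local_isos F"
proof -
  have "Dom A v \<in> F"
    using Dom_rlp_local[OF local_isos_subset_Mor v(1)] local_objects_local_isos[OF F(1)] i v
    by simp
  moreover have "v \<in> Mor A" using v rlp_subset_Mor by blast
  ultimately show ?thesis using semi_left_exact_pullback[OF F(2) i, of v] v(2) by metis
qed

lemma pushout_along_cofibration:
  assumes "coreflective C" "semi_right_exact C" "p \<in> colocal_isos C" "Dom A p \<in> C"
    "u \<in> llp (colocal_isos C)" "Dom A u = Dom A p"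
  shows "\<exists>w q. pushout_square p u w q \<and> q \<in> colocal_isos C"
  using category.pullback_along_fibration[OF dual_category, of C p u] assms
  by (simp add: dual_simps)

lemma Phi_in_bireflective_model_structures:
  assumes p: "(C, F) \<in> bireflective_pairs"
  shows "Phi (C, F) \<in> bireflective_model_structures"
proof -
  note co = compatible_bireflective_pair[OF p]
  have C: "coreflective C" "semi_right_exact C" and F: "reflective F" "semi_left_exact F"
    using p by (auto simp: mem_bireflective_pairs_iff)
  \<comment> \<open>Opaque names keep the classes in the form rewritten by \<open>TF\<close> and
    \<open>TC\<close>; \<open>d\<close> is unfolded only afterwards.\<close>
  define E1 M1 E2 M2 where d: "E1 = local_isos F" "M1 = rlp (local_isos F)"
    "E2 = llp (colocal_isos C)" "M2 = colocal_isos C"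
  note co = co[folded d]
  have fs: "factorization_system E1 M1" "factorization_system E2 M2"
    and t: "two_out_of_three E1" "two_out_of_three M2"
    using co by (auto simp: compatible_def)
  note D1 = factorization_systemD[OF fs(1)] and D2 = factorization_systemD[OF fs(2)]
  note TF = trivial_fibrations[OF co] and TC = trivial_cofibrations[OF co]
  have cF: "fibrant_objects (E2, M1, class_comp M2 E1) = F"
    and cC: "cofibrant_objects (E2, M1, class_comp M2 E1) = C"
    using local_objects_local_isos[OF F(1)] colocal_objects_colocal_isos[OF C(1)]
    by (simp_all add: fibrant_objects_eq cofibrant_objects_eq TF TC) (simp_all add: d)
  have "retract_closed E2" "retract_closed M1"
    using retract_closed_llp[OF D2(4)] retract_closed_rlp[OF D1(3)] D2(1) D1(2) by auto
  then have "model_structure (E2, M1, class_comp M2 E1)"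
    using D1(3-6) D2(3-6) two_out_of_three_weak_equivalences[OF co]
      retract_closed_weak_equivalences[OF co] weak_equivalences_subset_Mor[OF co]
      orthogonal_has_liftings[OF D1(5)] orthogonal_has_liftings[OF D2(5)]
    unfolding model_structure_def by (simp add: TF TC subset_iff)
  then have "orthogonal_model_structure (E2, M1, class_comp M2 E1)"
    using D1(5) D2(5) by (simp add: orthogonal_model_structure_def TF TC)
  moreover have "enough_fibrant (E2, M1, class_comp M2 E1)"
    "enough_cofibrant (E2, M1, class_comp M2 E1)"
    using reflective_enough[OF F(1)] coreflective_enough[OF C(1)]
    by (simp_all add: enough_fibrant_def enough_cofibrant_def cF cC TF TC) (simp_all add: d)
  moreover have "\<exists>w q. pushout_square p u w q \<and> q \<in> M2"
    if "p \<in> M2" "u \<in> E2" "Dom A p \<in> C" "Dom A u = Dom A p" for p u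
    using pushout_along_cofibration[OF C, of p u] that by (simp add: d)
  moreover have "\<exists>w j. pullback_square w j i v \<and> j \<in> E1"
    if "i \<in> E1" "v \<in> M1" "Cod A i \<in> F" "Cod A v = Cod A i" for i v
    using pullback_along_fibration[OF F, of i v] that by (simp add: d)
  ultimately have "(E2, M1, class_comp M2 E1) \<in> bireflective_model_structures"
    using t unfolding bireflective_model_structures_def mem_Collect_eq prod.case cF cC TF TC
    by (intro conjI ballI impI; simp)
  then show ?thesis by (simp add: Phi_eq[OF p] d)
qed

section \<open>From model structures to pairs\<close>

lemma
  assumes M: "(CoFib, Fib, Weq) \<in> bireflective_model_structures"
  shows Psi_in_bireflective_pairs: "Psi (CoFib, Fib, Weq) \<in> bireflective_pairs"
    and Phi_Psi: "Phi (Psi (CoFib, Fib, Weq)) = (CoFib, Fib, Weq)"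
proof -
  define T where "T = CoFib \<inter> Weq"
  define Q where "Q = Fib \<inter> Weq"
  define C where "C = colocal_objects Q"
  define F where "F = local_objects T"
  have FF: "fibrant_objects (CoFib, Fib, Weq) = F" and CC: "cofibrant_objects (CoFib, Fib, Weq) = C"
    by (simp_all add: fibrant_objects_eq cofibrant_objects_eq C_def F_def T_def Q_def)
  have Mor: "CoFib \<subseteq> Mor A" "Fib \<subseteq> Mor A" "Weq \<subseteq> Mor A"
    and W: "two_out_of_three Weq"
    and rc: "retract_closed CoFib" "retract_closed Fib" "retract_closed Weq"
    and fact: "Mor A \<subseteq> class_comp Fib T" "Mor A \<subseteq> class_comp Q CoFib"
    and orth: "orthogonal T Fib" "orthogonal CoFib Q"
    and enough: "\<And>X. X \<in> Ob A \<Longrightarrow> \<exists>G \<in> C. \<exists>p \<in> Q. p \<in> hom G X"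
      "\<And>X. X \<in> Ob A \<Longrightarrow> \<exists>G \<in> F. \<exists>i \<in> T. i \<in> hom X G"
    and t: "two_out_of_three T" "two_out_of_three Q"
    using M
    by (simp_all add: bireflective_model_structures_def orthogonal_model_structure_def
        model_structure_def enough_fibrant_def enough_cofibrant_def FF CC T_def[symmetric]
        Q_def[symmetric])
  have "\<forall>p \<in> Q. \<forall>u \<in> CoFib. Dom A p \<in> C \<longrightarrow> Dom A u = Dom A p \<longrightarrow>
      (\<exists>w q. pushout_square p u w q \<and> q \<in> Q)"
    and "\<forall>i \<in> T. \<forall>v \<in> Fib. Cod A i \<in> F \<longrightarrow> Cod A v = Cod A i \<longrightarrow>
      (\<exists>w j. pullback_square w j i v \<and> j \<in> T)"
    using M unfolding bireflective_model_structures_def mem_Collect_eq prod.case FF CC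
      T_def[symmetric] Q_def[symmetric] by blast+
  then have po: "\<And>p u. \<lbrakk>p \<in> Q; u \<in> CoFib; Dom A p \<in> C; Dom A u = Dom A p\<rbrakk>
      \<Longrightarrow> \<exists>w q. pushout_square p u w q \<and> q \<in> Q"
    and pb: "\<And>i v. \<lbrakk>i \<in> T; v \<in> Fib; Cod A i \<in> F; Cod A v = Cod A i\<rbrakk>
      \<Longrightarrow> \<exists>w j. pullback_square w j i v \<and> j \<in> T"
    by blast+
  have TM: "T \<subseteq> Mor A" and QM: "Q \<subseteq> Mor A" using Mor by (auto simp: T_def Q_def)
  have rT: "retract_closed T" and rQ: "retract_closed Q"
    using rc unfolding retract_closed_def T_def Q_def by blast+
  \<comment> \<open>The model axioms give orthogonality and factorizations; the closure under
    isomorphisms that is still required comes from closure under retracts.\<close>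
  have fs1: "factorization_system T Fib"
    by (rule factorization_systemI[OF TM Mor(2) orth(1) fact(1)])
      (blast intro: retract_closed_comp_iso[OF rc(2) Mor(2)] retract_closed_iso_comp[OF rT TM])+
  have fs2: "factorization_system CoFib Q"
    by (rule factorization_systemI[OF Mor(1) QM orth(2) fact(2)])
      (blast intro: retract_closed_comp_iso[OF rQ QM] retract_closed_iso_comp[OF rc(1) Mor(1)])+
  note D1 = factorization_systemD[OF fs1] and D2 = factorization_systemD[OF fs2]
  have T: "local_isos F = T"
    unfolding F_def by (rule local_isos_local_objects[OF fs1 t(1)]) (use enough in \<open>auto simp: F_def\<close>)
  have Q: "colocal_isos C = Q"
    unfolding C_def
    by (rule colocal_isos_colocal_objects[OF fs2 t(2)]) (use enough in \<open>auto simp: C_def\<close>)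
  have "reflective F" "coreflective C"
    unfolding F_def C_def
    using reflective_local_objects[OF fs1] coreflective_colocal_objects[OF fs2] enough
    by (simp_all add: F_def C_def)
  moreover have "semi_left_exact F"
    unfolding F_def
    by (rule semi_left_exact_local_objects[OF fs1 t(1)]) (use enough pb in \<open>auto simp: F_def\<close>)
  moreover have "semi_right_exact C"
    unfolding C_def
    by (rule semi_right_exact_colocal_objects[OF fs2 t(2)]) (use enough po in \<open>auto simp: C_def\<close>)
  moreover have "orthogonal T Q"
    by (rule orthogonal_mono[OF orth(1)]) (auto simp: Q_def)
  \<comment> \<open>Factor a weak equivalence into a trivial cofibration and a fibration: by
    two-out-of-three the fibration is trivial.\<close>
  moreover have WQT: "class_comp Q T = Weq"
  proof (intro equalityI subsetI)
    fix f assume "f \<in> class_comp Q T"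
    then obtain p i where "f = p \<cdot> i" "i \<in> T" "p \<in> Q" "Cod A i = Dom A p" by (rule class_compE)
    then show "f \<in> Weq"
      using two_out_of_threeD(1)[OF W, of i p] TM QM by (auto simp: T_def Q_def)
  next
    fix f assume f: "f \<in> Weq"
    then have "f \<in> class_comp Fib T" using fact(1) Mor(3) by blast
    then obtain p i where pi: "f = p \<cdot> i" "i \<in> T" "p \<in> Fib" "Cod A i = Dom A p"
      by (rule class_compE)
    then have "p \<in> Weq"
      using two_out_of_threeD(2)[OF W, of i p] f TM Mor by (auto simp: T_def)
    then show "f \<in> class_comp Q T" using pi by (auto simp: Q_def intro: class_compI)
  qed
  \<comment> \<open>With \<open>WQT\<close> this is the exchange condition (A3): weak equivalences
    compose in either order.\<close>
  moreover have "class_comp T Q \<subseteq> Weq"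
  proof
    fix f assume "f \<in> class_comp T Q"
    then obtain p i where "f = p \<cdot> i" "i \<in> Q" "p \<in> T" "Cod A i = Dom A p" by (rule class_compE)
    then show "f \<in> Weq"
      using two_out_of_threeD(1)[OF W, of i p] TM QM by (auto simp: T_def Q_def)
  qed
  ultimately have pair: "(C, F) \<in> bireflective_pairs"
    by (simp add: mem_bireflective_pairs_iff T Q)
  have Psi: "Psi (CoFib, Fib, Weq) = (C, F)" by (simp add: Psi_def FF CC)
  show "Psi (CoFib, Fib, Weq) \<in> bireflective_pairs" using pair Psi by simp
  show "Phi (Psi (CoFib, Fib, Weq)) = (CoFib, Fib, Weq)"
    by (simp add: Psi Phi_eq[OF pair] T Q D1(2) D2(1) WQT)
qed

end

text \<open>\<open>Phi\<close> is defined through adjoints fixed by choice; the last conjunct makes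
  the formula valid for every coreflector and reflector of the pair.\<close>

theorem theoremC:
  fixes A :: "('o, 'm) cat"
  assumes "category A"
  shows "bij_betw (category.Phi A) (category.bireflective_pairs A)
           (category.bireflective_model_structures A)
       \<and> (\<forall>p \<in> category.bireflective_pairs A. category.Psi A (category.Phi A p) = p)
       \<and> (\<forall>M \<in> category.bireflective_model_structures A.
            category.Psi A M \<in> category.bireflective_pairs A \<and>
            category.Phi A (category.Psi A M) = M)
       \<and> (\<forall>(C, F) \<in> category.bireflective_pairs A. \<forall>t \<epsilon> r \<eta>.
            category.coreflection A C t \<epsilon> \<longrightarrow> category.reflection A F r \<eta> \<longrightarrow>
            category.Phi A (C, F) = category.induced_model A t \<epsilon> r \<eta>)"
proof -
  interpret category A by (rule assms)
  have Psi_Phi': "Psi (Phi p) = p" and Phi: "Phi p \<in> bireflective_model_structures"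
    if "p \<in> bireflective_pairs" for p
    using that Psi_Phi Phi_in_bireflective_model_structures by (cases p; simp)+
  have Psi: "Psi M \<in> bireflective_pairs" and Phi_Psi': "Phi (Psi M) = M"
    if "M \<in> bireflective_model_structures" for M
    using that Psi_in_bireflective_pairs Phi_Psi by (cases M; simp)+
  have "bij_betw Phi bireflective_pairs bireflective_model_structures"
    by (rule bij_betw_byWitness[where f' = Psi]) (auto simp: Psi_Phi' Phi_Psi' Phi Psi)
  moreover have "Phi (C, F) = induced_model t \<epsilon> r \<eta>"
    if "(C, F) \<in> bireflective_pairs" "coreflection C t \<epsilon>" "reflection F r \<eta>" for C F t \<epsilon> r \<eta>
    using Phi_eq induced_model_eq that by metis
  ultimately show ?thesis
    using Psi_Phi' Psi Phi_Psi' by blast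
qed

end
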